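(* Let $m\ge1$ and let $F:\mathbb{R}^m\to\mathbb{R}$ be a smooth convex function satisfying on all of $\mathbb{R}^m$ the Monge–Ampère equation $$\det\left(\frac{\partial^2F}{\partial x^i\partial x^j}\right)=c$$ for some constant $c>0$. Then $F$ is a quadratic polynomial.
   Context: "Quadratic polynomial" means polynomial of degree at most two. *)

theory Defs
  imports "HOL-Analysis.Analysis"
begin

definition partial_deriv :: "'m::finite \<Rightarrow> (real^'m \<Rightarrow> real) \<Rightarrow> real^'m \<Rightarrow> real"
  where "partial_deriv i f x = deriv (\<lambda>t. f (x + t *\<^sub>R axis i 1)) 0"

definition hessian :: "(real^'m::finite \<Rightarrow> real) \<Rightarrow> real^'m \<Rightarrow> real^'m^'m"
  where "hessian f x = (\<chi> i j. partial_deriv i (partial_deriv j f) x)"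

text \<open>Class \<open>C\<^sup>k\<close> on the whole space. The directional derivatives in all directions carry the
  same information as the Frechet derivative, so that the recursion stays within
  real-valued functions.\<close>

primrec times_cont_diff :: "nat \<Rightarrow> ('a::euclidean_space \<Rightarrow> real) \<Rightarrow> bool"
  where
    "times_cont_diff 0 f \<longleftrightarrow> continuous_on UNIV f"
  | "times_cont_diff (Suc k) f \<longleftrightarrow>
      (\<forall>x. f differentiable (at x)) \<and>
      (\<forall>v. times_cont_diff k (\<lambda>x. frechet_derivative f (at x) v))"

definition smooth :: "('a::euclidean_space \<Rightarrow> real) \<Rightarrow> bool"
  where "smooth f \<longleftrightarrow> (\<forall>k. times_cont_diff k f)"

definition quadratic_polynomial :: "(real^'m::finite \<Rightarrow> real) \<Rightarrow> bool"
  where "quadratic_polynomial f \<longleftrightarrow>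
    (\<exists>(a :: 'm \<Rightarrow> 'm \<Rightarrow> real) (b :: 'm \<Rightarrow> real) (d :: real). \<forall>x.
      f x = (\<Sum>i\<in>UNIV. \<Sum>j\<in>UNIV. a i j * x $ i * x $ j) + (\<Sum>i\<in>UNIV. b i * x $ i) + d)"

end

theory Submission
  imports Defs
begin

text \<open>
  Write \<open>g = D\<^sup>2F\<close>. Convexity and \<open>det D\<^sup>2F > 0\<close> make \<open>g\<close> a Riemannian metric, and
  \<open>det D\<^sup>2F = c\<close> says that its volume form is a constant multiple of Lebesgue measure. The proof
  shows \<open>D\<^sup>3F = 0\<close> at an arbitrary point \<open>b\<close>. After subtraction of the tangent affine function,
  \<open>F \<ge> 0\<close> with \<open>F b = 0\<close>, and strict convexity makes every section \<open>{F \<le> M}\<close> compact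
  (\<open>compact_sublevel\<close>), so that a continuous function that is positive somewhere and has a factor
  vanishing on the boundary of the section attains its maximum in the interior. Two maximum principles on such sections suffice.

  First (\<open>gradient_estimate\<close>): the squared \<open>g\<close>-length of the gradient,
  \<open>P = sup (DF v)\<^sup>2 / g(v,v)\<close>, satisfies \<open>P (M - F)\<^sup>n \<le> (n\<^sup>2 + 3n) M\<^sup>n\<^sup>+\<^sup>1\<close>, whence \<open>P = O(M)\<close> on
  \<open>{F \<le> M/2}\<close>. This is a Bochner argument in the style of Cheng and Yau; the equation enters through
  the traces of \<open>D\<^sup>3F\<close> and \<open>D\<^sup>4F\<close> with respect to \<open>g\<close>, of which the former vanishes.

  Second (\<open>cubic_estimate\<close>): where \<open>D\<^sup>3F(v,v,v) / g(v,v)\<^sup>3\<^sup>/\<^sup>2\<close> times the cutoff \<open>\<eta> = M - F\<close> is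
  maximal over points and directions, its square is at most \<open>8 P + 4 n \<eta>\<close>. This replaces
  Calabi's differential inequality for \<open>|D\<^sup>3F|\<^sup>2\<close>. As the gradient estimate makes
  the right-hand side \<open>O(M)\<close> while \<open>\<eta>\<^sup>2\<close> is of order \<open>M\<^sup>2\<close> at \<open>b\<close>, letting \<open>M\<close> tend to infinity gives
  \<open>D\<^sup>3F(v,v,v) = 0\<close> at \<open>b\<close>.

  In both steps the quantity is maximised jointly over the point \<open>x\<close> and the vector \<open>v\<close>. At a
  maximum the second derivative along every straight curve \<open>s \<mapsto> (x + s y, v + s \<xi>)\<close> is
  nonpositive (\<open>log_max_test\<close>), and summing these inequalities over a \<open>g\<close>-orthonormal
  frame \<open>y = e\<^sub>a\<close>, with \<open>\<xi>\<^sub>a\<close> chosen as a covariant derivative would dictate, replaces the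
  Laplacian of \<open>g\<close>, its connection and its curvature. The traces of the fourth
  and fifth derivatives that arise are given by differentiating
  \<open>det D\<^sup>2F = c\<close> two and three times along a line (\<open>monge_ampere_traces\<close>).
\<close>

section \<open>Directional derivatives of smooth functions\<close>

text \<open>An operator on functions, so that a value \<open>D\<^sup>kF(v\<^sub>1,\<dots>,v\<^sub>k)\<close> of the
  \<open>k\<close>-th derivative is a composition of operators. Symmetry in the arguments is then
  commutation of the operators, and linearity in each argument follows from linearity in the
  first.\<close>

definition dd :: "'a::euclidean_space \<Rightarrow> ('a \<Rightarrow> real) \<Rightarrow> 'a \<Rightarrow> real"
  where "dd v f = (\<lambda>x. frechet_derivative f (at x) v)"

lemma smooth_dd: "smooth f \<Longrightarrow> smooth (dd v f)"
  unfolding smooth_def dd_def by (metis times_cont_diff.simps(2))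

lemma smooth_differentiable: "smooth f \<Longrightarrow> f differentiable (at x)"
  unfolding smooth_def by (metis times_cont_diff.simps(2))

lemma smooth_has_derivative: "smooth f \<Longrightarrow> (f has_derivative (\<lambda>v. dd v f x)) (at x)"
  unfolding dd_def using smooth_differentiable frechet_derivative_works by (metis (no_types, lifting) eta_contract_eq)

lemma smooth_continuous_on: "smooth f \<Longrightarrow> continuous_on S f"
  by (meson continuous_at_imp_continuous_on differentiable_imp_continuous_within smooth_differentiable)

lemma dd_eqI: "(f has_derivative f') (at x) \<Longrightarrow> dd v f x = f' v"
  unfolding dd_def using frechet_derivative_at by metis

lemma linear_dd: "smooth f \<Longrightarrow> linear (\<lambda>v. dd v f x)"
  using smooth_has_derivative has_derivative_linear by blast

lemma dd_line:
  assumes "smooth f"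
  shows "((\<lambda>s. f (x + s *\<^sub>R v)) has_real_derivative dd v f (x + s *\<^sub>R v)) (at s)"
proof -
  have "((\<lambda>s. x + s *\<^sub>R v) has_derivative (\<lambda>h. h *\<^sub>R v)) (at s)"
    by (auto intro!: derivative_eq_intros)
  from has_derivative_compose[OF this smooth_has_derivative[OF assms]]
  have "((\<lambda>s. f (x + s *\<^sub>R v)) has_derivative (\<lambda>h. dd (h *\<^sub>R v) f (x + s *\<^sub>R v))) (at s)" .
  moreover have "dd (h *\<^sub>R v) f (x + s *\<^sub>R v) = dd v f (x + s *\<^sub>R v) * h" for h
    using linear_cmul[OF linear_dd[OF assms]] by (simp add: mult.commute)
  ultimately show ?thesis by (simp add: has_field_derivative_def)
qed

lemma dd_sum_Basis:
  assumes "smooth f"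
  shows "dd v f x = (\<Sum>b\<in>Basis. (v \<bullet> b) * dd b f x)"
proof -
  have "dd v f x = dd (\<Sum>b\<in>Basis. (v \<bullet> b) *\<^sub>R b) f x" by (simp add: euclidean_representation)
  also have "\<dots> = (\<Sum>b\<in>Basis. (v \<bullet> b) * dd b f x)"
    using linear_sum[OF linear_dd[OF assms, of x], of "\<lambda>b. (v \<bullet> b) *\<^sub>R b" Basis]
      linear_cmul[OF linear_dd[OF assms, of x]] by (simp add: o_def)
  finally show ?thesis .
qed

text \<open>The second difference is symmetric in \<open>v\<close> and \<open>w\<close>, while the mean value theorem,
  applied first in direction \<open>v\<close> and then in direction \<open>w\<close>, exhibits one of the two mixed derivatives.
  Comparing the two orders for small \<open>h\<close> yields their equality.\<close>

lemma second_difference: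
  assumes f: "smooth f" and h: "0 < h"
  shows "\<exists>a b. 0 < a \<and> a < h \<and> 0 < b \<and> b < h \<and>
    f (x + h *\<^sub>R v + h *\<^sub>R w) - f (x + h *\<^sub>R v) - f (x + h *\<^sub>R w) + f x
      = h\<^sup>2 * dd w (dd v f) (x + a *\<^sub>R v + b *\<^sub>R w)"
proof -
  define A where "A s = f ((x + h *\<^sub>R w) + s *\<^sub>R v) - f (x + s *\<^sub>R v)" for s
  define A' where "A' s = dd v f ((x + h *\<^sub>R w) + s *\<^sub>R v) - dd v f (x + s *\<^sub>R v)" for s
  have "(A has_real_derivative A' s) (at s)" for s
    unfolding A_def A'_def by (intro DERIV_diff dd_line f)
  then obtain a where a: "0 < a" "a < h" "A h - A 0 = h * A' a"
    using MVT2[of 0 h A A'] h by auto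
  have "((\<lambda>t. dd v f ((x + a *\<^sub>R v) + t *\<^sub>R w)) has_real_derivative dd w (dd v f) ((x + a *\<^sub>R v) + t *\<^sub>R w)) (at t)" for t
    by (intro dd_line smooth_dd f)
  then obtain b where b: "0 < b" "b < h"
    "dd v f ((x + a *\<^sub>R v) + h *\<^sub>R w) - dd v f ((x + a *\<^sub>R v) + 0 *\<^sub>R w) = h * dd w (dd v f) ((x + a *\<^sub>R v) + b *\<^sub>R w)"
    using MVT2[OF h, of "\<lambda>t. dd v f ((x + a *\<^sub>R v) + t *\<^sub>R w)" "\<lambda>t. dd w (dd v f) ((x + a *\<^sub>R v) + t *\<^sub>R w)"] by auto
  have "A' a = h * dd w (dd v f) ((x + a *\<^sub>R v) + b *\<^sub>R w)"
    using b(3) by (simp add: A'_def algebra_simps)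
  with a(3) have "A h - A 0 = h\<^sup>2 * dd w (dd v f) ((x + a *\<^sub>R v) + b *\<^sub>R w)" by (simp add: power2_eq_square)
  moreover have "A h - A 0 = f (x + h *\<^sub>R v + h *\<^sub>R w) - f (x + h *\<^sub>R v) - f (x + h *\<^sub>R w) + f x"
    by (simp add: A_def algebra_simps)
  ultimately show ?thesis using a b by auto
qed

lemma dd_commute:
  assumes f: "smooth f"
  shows "dd v (dd w f) = dd w (dd v f)"
proof
  fix x
  show "dd v (dd w f) x = dd w (dd v f) x"
  proof (rule ccontr)
    assume ne: "dd v (dd w f) x \<noteq> dd w (dd v f) x"
    define e where "e = \<bar>dd v (dd w f) x - dd w (dd v f) x\<bar> / 2"
    have e: "e > 0" using ne by (simp add: e_def)
    have near: "\<exists>d>0. \<forall>a b. 0 < a \<and> a < d \<and> 0 < b \<and> b < d \<longrightarrow> \<bar>g (x + a *\<^sub>R p + b *\<^sub>R q) - g x\<bar> < e"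
      if g: "smooth g" for g p q
    proof -
      have "isCont g x" using g by (meson differentiable_imp_continuous_within smooth_differentiable)
      then obtain d where d: "d > 0" "\<And>y. dist y x < d \<Longrightarrow> dist (g y) (g x) < e"
        using e unfolding continuous_at_eps_delta by metis
      define k where "k = d / (norm p + norm q + 1)"
      have np: "norm p + norm q + 1 > 0" using norm_ge_zero[of p] norm_ge_zero[of q] by linarith
      have k: "k > 0" using d np by (simp add: k_def)
      have "\<bar>g (x + a *\<^sub>R p + b *\<^sub>R q) - g x\<bar> < e" if ab: "0 < a" "a < k" "0 < b" "b < k" for a b
      proof -
        have "norm (a *\<^sub>R p + b *\<^sub>R q) \<le> a * norm p + b * norm q"
          using norm_triangle_ineq[of "a *\<^sub>R p" "b *\<^sub>R q"] ab by simp
        also have "\<dots> \<le> k * norm p + k * norm q" using ab by (intro add_mono mult_right_mono) auto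
        also have "\<dots> < k * (norm p + norm q + 1)" using k by (simp add: algebra_simps)
        also have "\<dots> = d" using np by (simp add: k_def)
        finally have "dist (x + a *\<^sub>R p + b *\<^sub>R q) x < d" by (simp add: dist_norm add.assoc)
        from d(2)[OF this] show ?thesis by (simp add: dist_real_def)
      qed
      with k show ?thesis by blast
    qed
    obtain d1 where d1: "d1 > 0" "\<And>a b. 0 < a \<Longrightarrow> a < d1 \<Longrightarrow> 0 < b \<Longrightarrow> b < d1 \<Longrightarrow> \<bar>dd w (dd v f) (x + a *\<^sub>R v + b *\<^sub>R w) - dd w (dd v f) x\<bar> < e"
      using near[OF smooth_dd[OF smooth_dd[OF f]], of w v v w] by auto
    obtain d2 where d2: "d2 > 0" "\<And>a b. 0 < a \<Longrightarrow> a < d2 \<Longrightarrow> 0 < b \<Longrightarrow> b < d2 \<Longrightarrow> \<bar>dd v (dd w f) (x + a *\<^sub>R w + b *\<^sub>R v) - dd v (dd w f) x\<bar> < e"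
      using near[OF smooth_dd[OF smooth_dd[OF f]], of v w w v] by auto
    define h where "h = min d1 d2"
    have h: "h > 0" "h \<le> d1" "h \<le> d2" using d1 d2 by (auto simp: h_def)
    obtain a b where ab: "0 < a" "a < h" "0 < b" "b < h"
      "f (x + h *\<^sub>R v + h *\<^sub>R w) - f (x + h *\<^sub>R v) - f (x + h *\<^sub>R w) + f x
      = h\<^sup>2 * dd w (dd v f) (x + a *\<^sub>R v + b *\<^sub>R w)" using second_difference[OF f h(1), of x v w] by blast
    obtain a' b' where ab': "0 < a'" "a' < h" "0 < b'" "b' < h"
      "f (x + h *\<^sub>R w + h *\<^sub>R v) - f (x + h *\<^sub>R w) - f (x + h *\<^sub>R v) + f x
      = h\<^sup>2 * dd v (dd w f) (x + a' *\<^sub>R w + b' *\<^sub>R v)" using second_difference[OF f h(1), of x w v] by blast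
    have "x + h *\<^sub>R w + h *\<^sub>R v = x + h *\<^sub>R v + h *\<^sub>R w" by (simp add: algebra_simps)
    with ab(5) ab'(5)[unfolded this] have "h\<^sup>2 * dd w (dd v f) (x + a *\<^sub>R v + b *\<^sub>R w) = h\<^sup>2 * dd v (dd w f) (x + a' *\<^sub>R w + b' *\<^sub>R v)"
      by linarith
    then have "dd w (dd v f) (x + a *\<^sub>R v + b *\<^sub>R w) = dd v (dd w f) (x + a' *\<^sub>R w + b' *\<^sub>R v)"
      using h(1) by simp
    moreover have "\<bar>dd w (dd v f) (x + a *\<^sub>R v + b *\<^sub>R w) - dd w (dd v f) x\<bar> < e"
      by (rule d1(2)) (use ab h in linarith)+
    moreover have "\<bar>dd v (dd w f) (x + a' *\<^sub>R w + b' *\<^sub>R v) - dd v (dd w f) x\<bar> < e"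
      by (rule d2(2)) (use ab' h in linarith)+
    ultimately show False unfolding e_def by (smt (verit) field_sum_of_halves)
  qed
qed

lemma times_cont_diff_diff:
  "times_cont_diff k f \<Longrightarrow> times_cont_diff k g \<Longrightarrow> times_cont_diff k (\<lambda>x. f x - g x)"
proof (induction k arbitrary: f g)
  case 0
  then show ?case by (auto intro: continuous_intros)
next
  case (Suc k)
  have "((\<lambda>x. f x - g x) has_derivative (\<lambda>v. frechet_derivative f (at x) v - frechet_derivative g (at x) v)) (at x)" for x
    using Suc.prems by (auto intro!: derivative_intros simp: frechet_derivative_works[symmetric])
  then have "frechet_derivative (\<lambda>x. f x - g x) (at x) = (\<lambda>v. frechet_derivative f (at x) v - frechet_derivative g (at x) v)" for x
    using frechet_derivative_at by metis
  with Suc show ?case by simp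
qed

lemma times_cont_diff_const: "times_cont_diff k (\<lambda>x. c)"
  by (induction k arbitrary: c) auto

lemma times_cont_diff_linear:
  assumes "linear L" shows "times_cont_diff k (L :: 'a::euclidean_space \<Rightarrow> real)"
proof (cases k)
  case 0 then show ?thesis using assms by (simp add: linear_continuous_on linear_conv_bounded_linear)
next
  case (Suc j)
  have d: "(L has_derivative L) (at x)" for x
    using assms by (simp add: bounded_linear_imp_has_derivative linear_conv_bounded_linear)
  then have "frechet_derivative L (at x) = L" for x using frechet_derivative_at by metis
  with d Suc show ?thesis by (auto simp: times_cont_diff_const differentiable_def)
qed

lemma smooth_diff: "smooth f \<Longrightarrow> smooth g \<Longrightarrow> smooth (\<lambda>x. f x - g x)"
  by (simp add: smooth_def times_cont_diff_diff)
lemma smooth_const: "smooth (\<lambda>x. c)" by (simp add: smooth_def times_cont_diff_const)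
lemma smooth_linear: "linear L \<Longrightarrow> smooth L" by (simp add: smooth_def times_cont_diff_linear)

lemma dd_diff: "smooth f \<Longrightarrow> smooth g \<Longrightarrow> dd v (\<lambda>x. f x - g x) = (\<lambda>x. dd v f x - dd v g x)"
  by (rule ext, rule dd_eqI) (intro has_derivative_diff smooth_has_derivative)
lemma dd_const: "dd v (\<lambda>x. c) = (\<lambda>x. 0)"
  by (rule ext, rule dd_eqI) auto
lemma dd_linear: "linear L \<Longrightarrow> dd v L = (\<lambda>x. L v)"
  by (rule ext, rule dd_eqI) (simp add: bounded_linear_imp_has_derivative linear_conv_bounded_linear)

lemma hessian_eq_dd:
  assumes "smooth f"
  shows "hessian f x $ i $ j = dd (axis i 1) (dd (axis j 1) f) x"
proof -
  have p: "partial_deriv i g = dd (axis i 1) g" if "smooth g" for g :: "real^'m \<Rightarrow> real" and i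
    using dd_line[OF that, of _ "axis i 1" 0] by (auto simp: partial_deriv_def fun_eq_iff intro!: DERIV_imp_deriv)
  show ?thesis using assms by (simp add: hessian_def p smooth_dd)
qed

lemma dd_add_vec: "smooth f \<Longrightarrow> dd (u + w) f x = dd u f x + dd w f x"
  using linear_add[OF linear_dd] by blast
lemma dd_scaleR_vec: "smooth f \<Longrightarrow> dd (r *\<^sub>R u) f x = r * dd u f x"
  using linear_cmul[OF linear_dd] by fastforce
lemma dd_zero_vec: "smooth f \<Longrightarrow> dd 0 f x = 0"
  using linear_0[OF linear_dd] by blast
lemma dd_sum_vec:
  assumes f: "smooth f"
  shows "dd (\<Sum>b\<in>I. c b *\<^sub>R e b) f x = (\<Sum>b\<in>I. c b * dd (e b) f x)"
  using linear_sum[OF linear_dd[OF f, of x], of "\<lambda>b. c b *\<^sub>R e b" I] by (simp add: dd_scaleR_vec[OF f])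

lemma dd2_sum_vec: "smooth f \<Longrightarrow> dd u (dd (\<Sum>b\<in>I. c b *\<^sub>R e b) f) x = (\<Sum>b\<in>I. c b * dd u (dd (e b) f) x)"
  by (simp only: dd_commute[of f u] dd_sum_vec smooth_dd)

lemma dd2_scaleR_vec: "smooth f \<Longrightarrow> dd u (dd (r *\<^sub>R w) f) x = r * dd u (dd w f) x"
  by (simp only: dd_commute[of f u] dd_scaleR_vec smooth_dd)

lemma dd2_zero_vec: "smooth f \<Longrightarrow> dd u (dd 0 f) x = 0"
  by (simp only: dd_commute[of f u] dd_zero_vec smooth_dd)

lemma dd2_expand:
  assumes f: "smooth f"
  shows "dd (v + s *\<^sub>R w) (dd (v + s *\<^sub>R w) f) x
    = dd v (dd v f) x + s * (2 * dd v (dd w f) x + s * dd w (dd w f) x)"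
proof -
  let ?u = "v + s *\<^sub>R w"
  have "dd ?u (dd ?u f) x = dd v (dd ?u f) x + s * dd w (dd ?u f) x"
    by (simp add: dd_add_vec dd_scaleR_vec smooth_dd f)
  also have "\<dots> = dd ?u (dd v f) x + s * dd ?u (dd w f) x"
    by (simp only: dd_commute[OF f, of v ?u] dd_commute[OF f, of w ?u])
  also have "\<dots> = dd v (dd v f) x + s * dd w (dd v f) x + s * (dd v (dd w f) x + s * dd w (dd w f) x)"
    by (simp add: dd_add_vec dd_scaleR_vec smooth_dd f)
  finally show ?thesis by (simp add: dd_commute[OF f, of w v] algebra_simps)
qed

lemma dd3_expand:
  assumes f: "smooth f"
  shows "dd (v + s *\<^sub>R w) (dd (v + s *\<^sub>R w) (dd (v + s *\<^sub>R w) f)) x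
    = dd v (dd v (dd v f)) x + s * (3 * dd v (dd v (dd w f)) x + s * (3 * dd v (dd w (dd w f)) x + s * dd w (dd w (dd w f)) x))"
proof -
  let ?u = "v + s *\<^sub>R w"
  have c: "dd a (dd ?u (dd ?u f)) = dd ?u (dd ?u (dd a f))" for a
    by (simp only: dd_commute[OF smooth_dd[OF f], of a ?u] dd_commute[OF f, of a ?u])
  have "dd ?u (dd ?u (dd ?u f)) x = dd v (dd ?u (dd ?u f)) x + s * dd w (dd ?u (dd ?u f)) x"
    by (simp add: dd_add_vec dd_scaleR_vec smooth_dd f)
  also have "\<dots> = dd ?u (dd ?u (dd v f)) x + s * dd ?u (dd ?u (dd w f)) x"
    by (simp only: c)
  also have "\<dots> = dd v (dd v (dd v f)) x + s * (2 * dd v (dd w (dd v f)) x + s * dd w (dd w (dd v f)) x)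
    + s * (dd v (dd v (dd w f)) x + s * (2 * dd v (dd w (dd w f)) x + s * dd w (dd w (dd w f)) x))"
    by (simp only: dd2_expand smooth_dd f)
  also have "dd w (dd v f) = dd v (dd w f)" by (rule dd_commute[OF f])
  also have "dd w (dd v (dd w f)) = dd v (dd w (dd w f))" by (rule dd_commute[OF smooth_dd[OF f]])
  finally show ?thesis by (simp add: algebra_simps)
qed

lemma dd_zero_fun: "smooth f \<Longrightarrow> dd 0 f = (\<lambda>x. 0)"
  by (rule ext) (rule dd_zero_vec)

lemma dd2_scale: "smooth f \<Longrightarrow> dd (r *\<^sub>R u) (dd (r *\<^sub>R u) f) x = r\<^sup>2 * dd u (dd u f) x"
  by (simp add: dd2_scaleR_vec dd_scaleR_vec smooth_dd power2_eq_square)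

lemma dd3_scale:
  assumes f: "smooth f" shows "dd (r *\<^sub>R u) (dd (r *\<^sub>R u) (dd (r *\<^sub>R u) f)) x = r ^ 3 * dd u (dd u (dd u f)) x"
proof -
  let ?w = "r *\<^sub>R u"
  have "dd ?w (dd ?w (dd ?w f)) x = r\<^sup>2 * dd u (dd u (dd ?w f)) x" by (rule dd2_scale[OF smooth_dd[OF f]])
  also have "dd u (dd u (dd ?w f)) = dd ?w (dd u (dd u f))"
    by (simp only: dd_commute[OF f, of u ?w] dd_commute[OF smooth_dd[OF f], of u ?w])
  also have "dd ?w (dd u (dd u f)) x = r * dd u (dd u (dd u f)) x"
    by (intro dd_scaleR_vec smooth_dd f)
  also have "r\<^sup>2 * (r * dd u (dd u (dd u f)) x) = r ^ 3 * dd u (dd u (dd u f)) x"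
    by (simp add: power2_eq_square power3_eq_cube)
  finally show ?thesis .
qed

lemma continuous_dd1:
  assumes "smooth f"
  shows "continuous_on S (\<lambda>z. dd (snd z) f (fst z))"
proof -
  have eq: "(\<lambda>z. dd (snd z) f (fst z)) = (\<lambda>z. \<Sum>b\<in>Basis. (snd z \<bullet> b) * dd b f (fst z))"
    by (rule ext) (rule dd_sum_Basis[OF assms])
  show ?thesis unfolding eq
    by (intro continuous_intros continuous_on_compose2[OF smooth_continuous_on[OF smooth_dd[OF assms], of UNIV]]) auto
qed

lemma continuous_dd2:
  assumes f: "smooth f"
  shows "continuous_on S (\<lambda>z. dd (snd z) (dd (snd z) f) (fst z))"
proof -
  have "dd u (dd u f) x = (\<Sum>b\<in>Basis. (u \<bullet> b) * dd u (dd b f) x)" for u x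
    by (subst dd_sum_Basis[OF smooth_dd[OF f]]) (simp only: dd_commute[OF f, of _ u])
  then show ?thesis by (simp only:) (intro continuous_intros continuous_dd1 smooth_dd f)
qed

lemma continuous_dd3:
  assumes f: "smooth f"
  shows "continuous_on S (\<lambda>z. dd (snd z) (dd (snd z) (dd (snd z) f)) (fst z))"
proof -
  have c3: "dd b (dd u (dd u f)) = dd u (dd u (dd b f))" for b u
    by (simp only: dd_commute[OF smooth_dd[OF f], of b u u] dd_commute[OF f, of b u])
  have "dd u (dd u (dd u f)) x = (\<Sum>b\<in>Basis. (u \<bullet> b) * dd u (dd u (dd b f)) x)" for u x
    by (subst dd_sum_Basis[OF smooth_dd[OF smooth_dd[OF f]]]) (rule sum.cong[OF refl], subst c3, rule refl)
  then show ?thesis by (simp only:) (intro continuous_intros continuous_dd2 smooth_dd f)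
qed

section \<open>Second-order Taylor data and the maximum test\<close>

text \<open>The 2-jet of \<open>f\<close> at \<open>0\<close>. The sum, product and logarithm rules below compute
  the second derivative of a composite expression by matching its syntax, without naming the
  first derivative as a function.\<close>

definition jet2 :: "(real \<Rightarrow> real) \<Rightarrow> real \<Rightarrow> real \<Rightarrow> real \<Rightarrow> bool"
  where "jet2 f a b c \<longleftrightarrow> f 0 = a \<and>
    (\<exists>f'. (\<forall>\<^sub>F s in nhds 0. (f has_real_derivative f' s) (at s)) \<and> f' 0 = b \<and> (f' has_real_derivative c) (at 0))"

lemma jet2_const: "jet2 (\<lambda>s. k) k 0 0"
  unfolding jet2_def by (auto intro!: exI[of _ "\<lambda>s. 0"])

lemma jet2_id: "jet2 (\<lambda>s. s) 0 1 0"
  unfolding jet2_def by (auto intro!: exI[of _ "\<lambda>s. 1"])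

lemma jet2_add:
  assumes "jet2 f a b c" "jet2 g a' b' c'"
  shows "jet2 (\<lambda>s. f s + g s) (a + a') (b + b') (c + c')"
proof -
  obtain f' g' where f: "f 0 = a" "\<forall>\<^sub>F s in nhds 0. (f has_real_derivative f' s) (at s)" "f' 0 = b" "(f' has_real_derivative c) (at 0)"
    and g: "g 0 = a'" "\<forall>\<^sub>F s in nhds 0. (g has_real_derivative g' s) (at s)" "g' 0 = b'" "(g' has_real_derivative c') (at 0)"
    using assms unfolding jet2_def by blast
  have "\<forall>\<^sub>F s in nhds 0. ((\<lambda>s. f s + g s) has_real_derivative f' s + g' s) (at s)"
    using f(2) g(2) by eventually_elim (auto intro: DERIV_add)
  moreover have "((\<lambda>s. f' s + g' s) has_real_derivative c + c') (at 0)" by (intro DERIV_add f g)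
  ultimately show ?thesis unfolding jet2_def using f g by (auto intro!: exI[of _ "\<lambda>s. f' s + g' s"])
qed

lemma jet2_mult:
  assumes "jet2 f a b c" "jet2 g a' b' c'"
  shows "jet2 (\<lambda>s. f s * g s) (a * a') (b * a' + a * b') (c * a' + 2 * b * b' + a * c')"
proof -
  obtain f' g' where f: "f 0 = a" "\<forall>\<^sub>F s in nhds 0. (f has_real_derivative f' s) (at s)" "f' 0 = b" "(f' has_real_derivative c) (at 0)"
    and g: "g 0 = a'" "\<forall>\<^sub>F s in nhds 0. (g has_real_derivative g' s) (at s)" "g' 0 = b'" "(g' has_real_derivative c') (at 0)"
    using assms unfolding jet2_def by blast
  have "\<forall>\<^sub>F s in nhds 0. ((\<lambda>s. f s * g s) has_real_derivative f' s * g s + f s * g' s) (at s)"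
    using f(2) g(2) by eventually_elim (auto intro!: derivative_eq_intros)
  moreover have "(f has_real_derivative b) (at 0)" "(g has_real_derivative b') (at 0)"
    using eventually_nhds_x_imp_x[OF f(2)] eventually_nhds_x_imp_x[OF g(2)] f g by auto
  then have "((\<lambda>s. f' s * g s + f s * g' s) has_real_derivative c * a' + 2 * b * b' + a * c') (at 0)"
    using f g by (auto intro!: derivative_eq_intros)
  ultimately show ?thesis unfolding jet2_def using f g by (auto intro!: exI[of _ "\<lambda>s. f' s * g s + f s * g' s"])
qed

lemma jet2_eventually_pos:
  assumes "jet2 f a b c" "a > 0"
  shows "\<forall>\<^sub>F s in nhds 0. f s > 0"
proof -
  obtain f' where f: "f 0 = a" "\<forall>\<^sub>F s in nhds 0. (f has_real_derivative f' s) (at s)" "f' 0 = b"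
    using assms unfolding jet2_def by blast
  have "isCont f 0" using eventually_nhds_x_imp_x[OF f(2)] by (rule DERIV_isCont)
  then have "(f \<longlongrightarrow> a) (nhds 0)" using f(1) tendsto_at_iff_tendsto_nhds[of f 0] by (auto simp: isCont_def)
  then show ?thesis using order_tendstoD(1) assms(2) by blast
qed

lemma jet2_ln:
  assumes j: "jet2 f a b c" and a: "a > 0"
  shows "jet2 (\<lambda>s. ln (f s)) (ln a) (b / a) (c / a - (b / a)\<^sup>2)"
proof -
  obtain f' where f: "f 0 = a" "\<forall>\<^sub>F s in nhds 0. (f has_real_derivative f' s) (at s)" "f' 0 = b" "(f' has_real_derivative c) (at 0)"
    using j unfolding jet2_def by blast
  have f0: "(f has_real_derivative b) (at 0)" using eventually_nhds_x_imp_x[OF f(2)] f by auto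
  have "\<forall>\<^sub>F s in nhds 0. ((\<lambda>s. ln (f s)) has_real_derivative f' s / f s) (at s)"
    using f(2) jet2_eventually_pos[OF j a] by eventually_elim (auto intro!: derivative_eq_intros)
  moreover have "((\<lambda>s. f' s / f s) has_real_derivative c / a - (b / a)\<^sup>2) (at 0)"
    using f f0 a by (auto intro!: derivative_eq_intros simp: field_simps power2_eq_square)
  ultimately show ?thesis unfolding jet2_def using f by (auto intro!: exI[of _ "\<lambda>s. f' s / f s"])
qed

lemma jet2_line:
  assumes "smooth f" shows "jet2 (\<lambda>s. f (x + s *\<^sub>R y)) (f x) (dd y f x) (dd y (dd y f) x)"
  unfolding jet2_def using dd_line[OF assms, of x y] dd_line[OF smooth_dd[OF assms], of y x y 0]
  by (auto intro!: exI[of _ "\<lambda>s. dd y f (x + s *\<^sub>R y)"])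

lemma jet2_local_max:
  assumes j: "jet2 f a b c" and mx: "\<forall>\<^sub>F s in nhds 0. f s \<le> f 0"
  shows "b = 0 \<and> c \<le> 0"
proof -
  obtain f' where f: "f 0 = a" "\<forall>\<^sub>F s in nhds 0. (f has_real_derivative f' s) (at s)" "f' 0 = b" "(f' has_real_derivative c) (at 0)"
    using j unfolding jet2_def by blast
  have f0: "(f has_real_derivative b) (at 0)" using eventually_nhds_x_imp_x[OF f(2)] f by auto
  obtain d where d: "d > 0" "\<And>s. \<bar>s\<bar> < d \<Longrightarrow> f s \<le> f 0 \<and> (f has_real_derivative f' s) (at s)"
    using eventually_conj[OF mx f(2)] unfolding eventually_nhds_metric dist_real_def by auto
  have b: "b = 0" using DERIV_local_max[OF f0 d(1)] d(2) by auto
  have "c \<le> 0"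
  proof (rule ccontr)
    assume "\<not> c \<le> 0"
    then obtain k where k: "k > 0" "\<And>h. 0 < h \<Longrightarrow> h < k \<Longrightarrow> f' 0 < f' (0 + h)"
      using DERIV_pos_inc_right[OF f(4)] by auto
    define h where "h = min d k / 2"
    have h: "0 < h" "h < d" "h < k" using d k by (auto simp: h_def)
    have "(f has_real_derivative f' s) (at s)" if "0 \<le> s" "s \<le> h" for s using d(2)[of s] that h by auto
    then obtain z where z: "0 < z" "z < h" "f h - f 0 = (h - 0) * f' z"
      using MVT2[OF h(1), of f f'] by auto
    have "f' z > 0" using k(2)[of z] z h f(3) b by auto
    with z h have "f h > f 0" by (metis diff_gt_0_iff_gt diff_zero mult_pos_pos)
    with d(2)[of h] h show False by auto
  qed
  with b show ?thesis by simp
qed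

lemma jet2_cong: "jet2 f a b c \<Longrightarrow> (\<And>s. f s = g s) \<Longrightarrow> a = a' \<Longrightarrow> b = b' \<Longrightarrow> c = c' \<Longrightarrow> jet2 g a' b' c'"
  by (metis ext)

lemma jet2_dd:
  assumes f: "smooth f"
  shows "jet2 (\<lambda>s. dd (v + s *\<^sub>R w) f (x + s *\<^sub>R y))
    (dd v f x) (dd y (dd v f) x + dd w f x) (dd y (dd y (dd v f)) x + 2 * dd y (dd w f) x)"
  by (rule jet2_cong[OF jet2_add[OF jet2_line jet2_mult[OF jet2_id jet2_line]], of "dd v f" "dd w f" x y x y])
    (simp_all add: f smooth_dd dd_add_vec dd_scaleR_vec)

lemma jet2_dd2:
  assumes f: "smooth f"
  shows "jet2 (\<lambda>s. dd (v + s *\<^sub>R w) (dd (v + s *\<^sub>R w) f) (x + s *\<^sub>R y))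
    (dd v (dd v f) x) (dd y (dd v (dd v f)) x + 2 * dd v (dd w f) x)
    (dd y (dd y (dd v (dd v f))) x + 4 * dd y (dd v (dd w f)) x + 2 * dd w (dd w f) x)"
  by (rule jet2_cong[OF jet2_add[OF jet2_line jet2_mult[OF jet2_id jet2_add[OF
        jet2_mult[OF jet2_const jet2_line] jet2_mult[OF jet2_id jet2_line]]]],
        of "dd v (dd v f)" "dd v (dd w f)" "dd w (dd w f)" x y 2 x y x y])
    (simp_all add: f smooth_dd dd2_expand)

lemma jet2_dd3:
  assumes f: "smooth f"
  shows "jet2 (\<lambda>s. dd (v + s *\<^sub>R w) (dd (v + s *\<^sub>R w) (dd (v + s *\<^sub>R w) f)) (x + s *\<^sub>R y))
    (dd v (dd v (dd v f)) x) (dd y (dd v (dd v (dd v f))) x + 3 * dd v (dd v (dd w f)) x)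
    (dd y (dd y (dd v (dd v (dd v f)))) x + 6 * dd y (dd v (dd v (dd w f))) x + 6 * dd v (dd w (dd w f)) x)"
  by (rule jet2_cong[OF jet2_add[OF jet2_line jet2_mult[OF jet2_id jet2_add[OF
        jet2_mult[OF jet2_const jet2_line] jet2_mult[OF jet2_id jet2_add[OF jet2_mult[OF jet2_const jet2_line] jet2_mult[OF jet2_id jet2_line]]]]]],
        of "dd v (dd v (dd v f))" "dd v (dd v (dd w f))" "dd v (dd w (dd w f))" "dd w (dd w (dd w f))" x y 3 x y 3 x y x y])
    (simp_all add: f smooth_dd dd3_expand)

lemma jet2_height:
  assumes f: "smooth f"
  shows "jet2 (\<lambda>s. M - f (x + s *\<^sub>R y)) (M - f x) (- dd y f x) (- dd y (dd y f) x)"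
  by (rule jet2_cong[OF jet2_add[OF jet2_const jet2_mult[OF jet2_const jet2_line]], of f M "-1" x y])
    (simp_all add: f)

text \<open>The form in which maximality is used: \<open>u\<close>, \<open>q\<close> and \<open>h\<close> are the factors of a
  product of powers, restricted to a curve through the maximum.\<close>

lemma log_max_test:
  assumes u: "jet2 u u0 u1 u2" "u0 > 0" and q: "jet2 q q0 q1 q2" "q0 > 0" and h: "jet2 h h0 h1 h2" "h0 > 0"
    and mx: "\<And>s. u s > 0 \<Longrightarrow> q s > 0 \<Longrightarrow> h s > 0 \<Longrightarrow>
      \<alpha> * ln (u s) + (\<beta> * ln (q s) + \<gamma> * ln (h s)) \<le> \<alpha> * ln u0 + (\<beta> * ln q0 + \<gamma> * ln h0)"
  shows "\<alpha> * (u1 / u0) + (\<beta> * (q1 / q0) + \<gamma> * (h1 / h0)) = 0"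
    and "\<alpha> * (u2 / u0 - (u1 / u0)\<^sup>2) + (\<beta> * (q2 / q0 - (q1 / q0)\<^sup>2) + \<gamma> * (h2 / h0 - (h1 / h0)\<^sup>2)) \<le> 0"
proof -
  have 0: "u 0 = u0" "q 0 = q0" "h 0 = h0" using u q h by (auto simp: jet2_def)
  note j = jet2_add[OF jet2_mult[OF jet2_const[of \<alpha>] jet2_ln[OF u]]
      jet2_add[OF jet2_mult[OF jet2_const[of \<beta>] jet2_ln[OF q]] jet2_mult[OF jet2_const[of \<gamma>] jet2_ln[OF h]]]]
  have "\<forall>\<^sub>F s in nhds 0. \<alpha> * ln (u s) + (\<beta> * ln (q s) + \<gamma> * ln (h s)) \<le> \<alpha> * ln (u 0) + (\<beta> * ln (q 0) + \<gamma> * ln (h 0))"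
    using jet2_eventually_pos[OF u] jet2_eventually_pos[OF q] jet2_eventually_pos[OF h]
    by eventually_elim (simp add: mx 0)
  from jet2_local_max[OF j this]
  show "\<alpha> * (u1 / u0) + (\<beta> * (q1 / q0) + \<gamma> * (h1 / h0)) = 0"
    and "\<alpha> * (u2 / u0 - (u1 / u0)\<^sup>2) + (\<beta> * (q2 / q0 - (q1 / q0)\<^sup>2) + \<gamma> * (h2 / h0 - (h1 / h0)\<^sup>2)) \<le> 0"
    by simp_all
qed

section \<open>Differentiating the determinant equation\<close>

text \<open>In the Leibniz formula, a permutation other than the
  identity moves at least two indices, so each term of its derivative at the identity matrix
  retains a vanishing off-diagonal factor.\<close>

lemma det_has_derivative_at_identity:
  fixes K :: "real \<Rightarrow> real^'n::finite^'n"
  assumes d: "\<And>i j. ((\<lambda>s. K s $ i $ j) has_real_derivative K1 $ i $ j) (at s0)"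
    and id: "K s0 = mat 1"
  shows "((\<lambda>s. det (K s)) has_real_derivative trace K1) (at s0)"
proof -
  let ?P = "{p. p permutes (UNIV::'n set)}"
  define D where "D p = of_int (sign p) * (\<Sum>i\<in>UNIV. K1 $ i $ p i * (\<Prod>j\<in>UNIV - {i}. K s0 $ j $ p j))" for p
  have fin: "finite ?P" by simp
  have "((\<lambda>s. det (K s)) has_real_derivative (\<Sum>p\<in>?P. D p)) (at s0)"
    unfolding det_def D_def by (intro DERIV_sum DERIV_cmult has_field_derivative_prod d)
  moreover have "D p = 0" if p: "p \<in> ?P - {id}" for p
  proof -
    have inj: "inj p" using p permutes_inj by blast
    obtain k where k: "p k \<noteq> k" using p by (auto simp: fun_eq_iff)
    have k2: "p (p k) \<noteq> p k" using k inj by (meson injD)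
    have "(\<Prod>j\<in>UNIV - {i}. K s0 $ j $ p j) = 0" for i
    proof -
      obtain j where "j \<noteq> i" "p j \<noteq> j" using k k2 by metis
      then have "K s0 $ j $ p j = 0" by (simp add: id mat_def)
      with \<open>j \<noteq> i\<close> show ?thesis by (intro prod_zero) auto
    qed
    then show ?thesis by (simp only: D_def mult_zero_right sum.neutral_const)
  qed
  then have "(\<Sum>p\<in>?P. D p) = (\<Sum>p\<in>{id}. D p)"
    by (intro sum.mono_neutral_right fin) (auto simp: permutes_id)
  moreover have "D id = trace K1"
    by (simp add: D_def id mat_def trace_def sign_id)
  ultimately show ?thesis by simp
qed

lemma matrix_mul_lminus: "(- A) ** B = - (A ** B)" for A B :: "real^'n::finite^'n"
  by (simp add: vec_eq_iff matrix_matrix_mult_def sum_negf)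

lemma matrix_mul_rminus: "A ** (- B) = - (A ** B)" for A B :: "real^'n::finite^'n"
  by (simp add: vec_eq_iff matrix_matrix_mult_def sum_negf)

lemma matrix_add_rdistrib: "(A + B) ** C = A ** C + B ** C" for A B C :: "real^'n::finite^'n"
  by (simp add: vec_eq_iff matrix_matrix_mult_def distrib_right sum.distrib)

lemma matrix_diff_rdistrib: "(A - B) ** C = A ** C - B ** C" for A B C :: "real^'n::finite^'n"
  by (simp add: vec_eq_iff matrix_matrix_mult_def left_diff_distrib sum_subtractf)

lemma trace_uminus: "trace (- A) = - trace A" for A :: "real^'n::finite^'n"
  by (simp add: trace_def sum_negf)

lemma matrix_mul_two: "(2 * A) ** B = 2 * (A ** B)" for A B :: "real^'n::finite^'n"
  by (simp only: mult_2 matrix_add_rdistrib)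

lemma trace_two: "trace (2 * A) = 2 * trace A" for A :: "real^'n::finite^'n"
  by (simp only: mult_2 trace_add)

definition entrywise_deriv :: "(real \<Rightarrow> real^'n::finite^'n) \<Rightarrow> (real \<Rightarrow> real^'n^'n) \<Rightarrow> bool"
  where "entrywise_deriv K K' \<longleftrightarrow> (\<forall>s i j. ((\<lambda>s. K s $ i $ j) has_real_derivative K' s $ i $ j) (at s))"

lemma entrywise_deriv_mult:
  assumes "entrywise_deriv K K'" "entrywise_deriv L L'"
  shows "entrywise_deriv (\<lambda>s. K s ** L s) (\<lambda>s. K' s ** L s + K s ** L' s)"
  using assms unfolding entrywise_deriv_def matrix_matrix_mult_def
  by (auto simp: sum.distrib[symmetric] intro!: derivative_eq_intros sum.cong)

lemma entrywise_deriv_add: "entrywise_deriv K K' \<Longrightarrow> entrywise_deriv L L' \<Longrightarrow> entrywise_deriv (\<lambda>s. K s + L s) (\<lambda>s. K' s + L' s)"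
  unfolding entrywise_deriv_def by (auto intro: DERIV_add)

lemma entrywise_deriv_minus: "entrywise_deriv K K' \<Longrightarrow> entrywise_deriv (\<lambda>s. - K s) (\<lambda>s. - K' s)"
  unfolding entrywise_deriv_def by (auto intro: DERIV_minus)

lemma trace_deriv_zero:
  assumes K: "entrywise_deriv K K'" and t: "\<And>s. trace (K s) = 0"
  shows "trace (K' s) = 0"
proof -
  have "((\<lambda>s. trace (K s)) has_real_derivative trace (K' s)) (at s)"
    using K unfolding entrywise_deriv_def trace_def by (intro DERIV_sum) auto
  then have "((\<lambda>s. 0) has_real_derivative trace (K' s)) (at s)" by (simp add: t)
  then show ?thesis using DERIV_unique DERIV_const by blast
qed

text \<open>By Cramer's rule the entries of the inverse are determinants, hence
  differentiable; the derivative is then determined by differentiating \<open>K N = 1\<close>.\<close>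

lemma entrywise_deriv_inverse:
  assumes K: "entrywise_deriv K K1" and det1: "\<And>s. det (K s) = 1"
  obtains N where "\<And>s. N s ** K s = mat 1" "\<And>s. K s ** N s = mat 1" "entrywise_deriv N (\<lambda>s. - (N s ** K1 s ** N s))"
proof -
  define N where "N s = (\<chi> i j. det (\<chi> a b. if b = i then axis j 1 $ a else K s $ a $ b))" for s
  have "K s *v (\<chi> i. N s $ i $ j) = axis j 1" for s j
    using cramer[of "K s" "(\<chi> i. N s $ i $ j)" "axis j 1"] by (simp add: det1 N_def)
  then have "(K s *v (\<chi> i. N s $ i $ j)) $ i = axis j 1 $ i" for s i j by simp
  then have KN: "K s ** N s = mat 1" for s
    by (simp add: vec_eq_iff matrix_matrix_mult_def matrix_vector_mult_def mat_def axis_def)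
  then have NK: "N s ** K s = mat 1" for s using matrix_left_right_inverse by blast
  have "\<exists>D. ((\<lambda>s. N s $ i $ j) has_real_derivative D) (at s)" for i j s
  proof -
    define M where "M s = (\<chi> a b. if b = i then axis j 1 $ a else K s $ a $ b)" for s
    define M1 where "M1 = (\<chi> a b. if b = i then 0 else K1 s $ a $ b)"
    have d: "((\<lambda>s. M s $ a $ b) has_real_derivative M1 $ a $ b) (at s)" for a b
      using K by (cases "b = i") (auto simp: M_def M1_def entrywise_deriv_def)
    have "((\<lambda>s. det (M s)) has_real_derivative (\<Sum>p\<in>{p. p permutes UNIV}.
       of_int (sign p) * (\<Sum>i\<in>UNIV. M1 $ i $ p i * (\<Prod>j\<in>UNIV - {i}. M s $ j $ p j)))) (at s)"
      unfolding det_def by (intro DERIV_sum DERIV_cmult has_field_derivative_prod d)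
    then show ?thesis by (auto simp: N_def M_def)
  qed
  then obtain D where D: "\<And>i j s. ((\<lambda>s. N s $ i $ j) has_real_derivative D i j s) (at s)" by metis
  define N1 where "N1 s = (\<chi> i j. D i j s)" for s
  have N1: "entrywise_deriv N N1" using D by (simp add: entrywise_deriv_def N1_def)
  have eq: "N1 s = - (N s ** K1 s ** N s)" for s
  proof -
    have "entrywise_deriv (\<lambda>s. mat 1) (\<lambda>s. K1 s ** N s + K s ** N1 s)"
      using entrywise_deriv_mult[OF K N1] by (simp add: KN)
    then have "((\<lambda>s. (mat 1 :: real^'a^'a) $ i $ j) has_real_derivative (K1 s ** N s + K s ** N1 s) $ i $ j) (at s)" for i j
      by (simp add: entrywise_deriv_def)
    then have "(K1 s ** N s + K s ** N1 s) $ i $ j = 0" for i j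
      using DERIV_unique DERIV_const by blast
    then have "K1 s ** N s + K s ** N1 s = 0" by (simp add: vec_eq_iff)
    then have "K s ** N1 s = - (K1 s ** N s)" by (simp add: add_eq_0_iff)
    then have "N s ** (K s ** N1 s) = - (N s ** K1 s ** N s)" by (simp add: matrix_mul_rminus matrix_mul_assoc)
    then show ?thesis by (simp add: matrix_mul_assoc NK)
  qed
  have "N1 = (\<lambda>s. - (N s ** K1 s ** N s))" using eq by auto
  with N1 KN NK that show ?thesis by auto
qed

text \<open>With \<open>N\<close> the inverse of \<open>K\<close>, the first derivative of \<open>det K = 1\<close>
  at any parameter is \<open>tr (N K') = 0\<close>. Differentiating this identity twice more, with
  \<open>N' = - N K' N\<close>, and evaluating where \<open>N = 1\<close> gives the other two.\<close>

lemma traces_of_constant_det: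
  fixes K :: "real \<Rightarrow> real^'n::finite^'n"
  assumes K: "entrywise_deriv K K1" and K1: "entrywise_deriv K1 K2" and K2: "entrywise_deriv K2 K3"
    and det1: "\<And>s. det (K s) = 1" and id: "K 0 = mat 1"
  shows "trace (K1 0) = 0"
    and "trace (K2 0) = trace (K1 0 ** K1 0)"
    and "trace (K3 0) = 3 * trace (K1 0 ** K2 0) - 2 * trace (K1 0 ** K1 0 ** K1 0)"
proof -
  obtain N where N: "\<And>s. N s ** K s = mat 1" "\<And>s. K s ** N s = mat 1" and dN: "entrywise_deriv N (\<lambda>s. - (N s ** K1 s ** N s))"
    using entrywise_deriv_inverse[OF K det1] by blast
  have t0: "trace (N s ** K1 s) = 0" for s
  proof -
    have "((\<lambda>r. det (N s ** K r)) has_real_derivative trace (N s ** K1 s)) (at s)"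
    proof (rule det_has_derivative_at_identity)
      show "N s ** K s = mat 1" by (rule N)
      show "((\<lambda>r. (N s ** K r) $ i $ j) has_real_derivative (N s ** K1 s) $ i $ j) (at s)" for i j
        using K unfolding matrix_matrix_mult_def entrywise_deriv_def
        by (auto intro!: DERIV_sum DERIV_cmult)
    qed
    moreover have "det (N s ** K r) = det (N s)" for r by (simp add: det_mul det1)
    ultimately have "((\<lambda>r. det (N s)) has_real_derivative trace (N s ** K1 s)) (at s)" by simp
    then show ?thesis using DERIV_unique DERIV_const by blast
  qed
  have N0: "N 0 = mat 1" using N(1)[of 0] by (simp add: id)
  note d1 = entrywise_deriv_mult[OF dN K1]
  note t1 = trace_deriv_zero[OF d1 t0]
  note dN1 = entrywise_deriv_minus[OF entrywise_deriv_mult[OF entrywise_deriv_mult[OF dN K1] dN]]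
  note d2 = entrywise_deriv_add[OF entrywise_deriv_mult[OF dN1 K1] entrywise_deriv_mult[OF dN K2]]
  show "trace (K1 0) = 0" using t0[of 0] by (simp add: N0)
  show "trace (K2 0) = trace (K1 0 ** K1 0)" using t1[of 0]
    by (simp add: N0 trace_add trace_sub matrix_mul_lminus trace_uminus)
  have "trace (K1 0 ** K2 0) = trace (K2 0 ** K1 0)" by (rule trace_mul_sym)
  then show "trace (K3 0) = 3 * trace (K1 0 ** K2 0) - 2 * trace (K1 0 ** K1 0 ** K1 0)"
    using trace_deriv_zero[OF d2 t1, of 0]
    by (simp add: N0 trace_add trace_sub matrix_mul_lminus matrix_mul_rminus trace_uminus matrix_add_rdistrib matrix_diff_rdistrib
      matrix_mul_two trace_two)
qed

lemma dd_axis: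
  fixes f :: "real^'m::finite \<Rightarrow> real"
  assumes "smooth f"
  shows "dd v f x = (\<Sum>i\<in>UNIV. v $ i * dd (axis i 1) f x)"
proof -
  have "dd v f x = dd (\<Sum>i\<in>UNIV. v $ i *\<^sub>R axis i 1) f x"
    using basis_expansion[of v] by (simp add: scalar_mult_eq_scaleR)
  also have "\<dots> = (\<Sum>i\<in>UNIV. v $ i * dd (axis i 1) f x)"
    using linear_sum[OF linear_dd[OF assms, of x], of "\<lambda>i. v $ i *\<^sub>R axis i 1" UNIV]
      linear_cmul[OF linear_dd[OF assms, of x]] by (simp add: o_def)
  finally show ?thesis .
qed

lemma dd2_hessian:
  fixes f :: "real^'m::finite \<Rightarrow> real"
  assumes "smooth f"
  shows "dd u (dd w f) x = (\<Sum>i\<in>UNIV. \<Sum>j\<in>UNIV. u $ i * hessian f x $ i $ j * w $ j)"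
proof -
  have sym: "dd (axis j 1) (dd (axis i 1) f) x = hessian f x $ i $ j" for i j
    using hessian_eq_dd[OF assms, of x i j] dd_commute[OF assms, of "axis i 1" "axis j 1"] by simp
  have "dd u (dd w f) x = (\<Sum>i\<in>UNIV. u $ i * dd (axis i 1) (dd w f) x)"
    by (rule dd_axis[OF smooth_dd[OF assms]])
  also have "\<dots> = (\<Sum>i\<in>UNIV. u $ i * dd w (dd (axis i 1) f) x)"
    by (simp add: dd_commute[OF assms, of w])
  also have "\<dots> = (\<Sum>i\<in>UNIV. u $ i * (\<Sum>j\<in>UNIV. w $ j * dd (axis j 1) (dd (axis i 1) f) x))"
    by (simp add: dd_axis[OF smooth_dd[OF assms], of w])
  also have "\<dots> = (\<Sum>i\<in>UNIV. u $ i * (\<Sum>j\<in>UNIV. w $ j * hessian f x $ i $ j))"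
    by (simp add: sym)
  finally show ?thesis by (simp add: sum_distrib_left mult_ac)
qed

text \<open>In a \<open>g\<close>-orthonormal frame \<open>e\<close> at \<open>x\<close>, the Gram matrix of \<open>D\<^sup>2F\<close> at
  \<open>x + s v\<close> differs from the Hessian by a constant congruence, so its determinant is constant in
  \<open>s\<close>; it is the identity at \<open>s = 0\<close>.\<close>

lemma monge_ampere_traces:
  fixes F :: "real^'m::finite \<Rightarrow> real" and e :: "'m \<Rightarrow> real^'m" and v :: "real^'m"
  assumes F: "smooth F" and ma: "\<And>x. det (hessian F x) = c"
    and on: "\<And>i j. dd (e i) (dd (e j) F) x = (if i = j then 1 else 0)"
  defines "A \<equiv> \<lambda>i j. dd v (dd (e i) (dd (e j) F)) x"
    and "T \<equiv> \<lambda>i j. dd v (dd v (dd (e i) (dd (e j) F))) x"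
    and "R \<equiv> \<lambda>i j. dd v (dd v (dd v (dd (e i) (dd (e j) F)))) x"
  shows "(\<Sum>i\<in>UNIV. A i i) = 0"
    and "(\<Sum>i\<in>UNIV. T i i) = (\<Sum>i\<in>UNIV. \<Sum>j\<in>UNIV. A i j * A j i)"
    and "(\<Sum>i\<in>UNIV. R i i) = 3 * (\<Sum>i\<in>UNIV. \<Sum>j\<in>UNIV. A i j * T j i) - 2 * (\<Sum>i\<in>UNIV. \<Sum>j\<in>UNIV. \<Sum>k\<in>UNIV. A i k * A k j * A j i)"
proof -
  define E :: "real^'m^'m" where "E = (\<chi> i a. e a $ i)"
  define K where "K s = (\<chi> i j. dd (e i) (dd (e j) F) (x + s *\<^sub>R v))" for s
  define K1 where "K1 s = (\<chi> i j. dd v (dd (e i) (dd (e j) F)) (x + s *\<^sub>R v))" for s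
  define K2 where "K2 s = (\<chi> i j. dd v (dd v (dd (e i) (dd (e j) F))) (x + s *\<^sub>R v))" for s
  define K3 where "K3 s = (\<chi> i j. dd v (dd v (dd v (dd (e i) (dd (e j) F)))) (x + s *\<^sub>R v))" for s
  have d: "entrywise_deriv K K1" "entrywise_deriv K1 K2" "entrywise_deriv K2 K3"
    unfolding entrywise_deriv_def K_def K1_def K2_def K3_def by (auto intro!: dd_line smooth_dd F)
  have id: "K 0 = mat 1" by (simp add: K_def on vec_eq_iff mat_def)
  have "K s $ a $ b = (transpose E ** hessian F (x + s *\<^sub>R v) ** E) $ a $ b" for s a b
  proof -
    have "K s $ a $ b = (\<Sum>i\<in>UNIV. \<Sum>j\<in>UNIV. e a $ i * hessian F (x + s *\<^sub>R v) $ i $ j * e b $ j)"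
      by (simp add: K_def dd2_hessian[OF F])
    also have "\<dots> = (\<Sum>j\<in>UNIV. \<Sum>i\<in>UNIV. e a $ i * hessian F (x + s *\<^sub>R v) $ i $ j * e b $ j)"
      by (rule sum.swap)
    also have "\<dots> = (transpose E ** hessian F (x + s *\<^sub>R v) ** E) $ a $ b"
      by (simp add: E_def matrix_matrix_mult_def transpose_def sum_distrib_right)
    finally show ?thesis .
  qed
  then have Keq: "K s = transpose E ** hessian F (x + s *\<^sub>R v) ** E" for s
    by (simp add: vec_eq_iff)
  have detK: "det (K s) = det E * c * det E" for s
    unfolding Keq by (simp add: det_mul ma)
  have "det (K s) = det (K 0)" for s by (simp only: detK)
  then have det1: "det (K s) = 1" for s by (simp add: id)
  note t = traces_of_constant_det[OF d det1 id]
  show "(\<Sum>i\<in>UNIV. A i i) = 0" using t(1) by (simp add: trace_def K1_def A_def)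
  show "(\<Sum>i\<in>UNIV. T i i) = (\<Sum>i\<in>UNIV. \<Sum>j\<in>UNIV. A i j * A j i)"
    using t(2) by (simp add: trace_def K1_def K2_def A_def T_def matrix_matrix_mult_def)
  show "(\<Sum>i\<in>UNIV. R i i) = 3 * (\<Sum>i\<in>UNIV. \<Sum>j\<in>UNIV. A i j * T j i) - 2 * (\<Sum>i\<in>UNIV. \<Sum>j\<in>UNIV. \<Sum>k\<in>UNIV. A i k * A k j * A j i)"
    using t(3) by (simp add: trace_def K1_def K2_def K3_def A_def T_def R_def matrix_matrix_mult_def sum_distrib_right)
qed

section \<open>Frames orthonormal for the Hessian metric\<close>

text \<open>Gram--Schmidt, started at \<open>v\<close> and stopped at the cardinality of the index
  type.\<close>

lemma orthonormal_basis_containing: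
  fixes g :: "real^'m::finite \<Rightarrow> real^'m \<Rightarrow> real"
  assumes lin: "\<And>w. linear (\<lambda>u. g u w)" and sym: "\<And>u w. g u w = g w u"
    and pos: "\<And>u. u \<noteq> 0 \<Longrightarrow> g u u > 0" and v: "g v v = 1"
  obtains e :: "'m \<Rightarrow> real^'m" and k where "e k = v" "\<And>i j. g (e i) (e j) = (if i = j then 1 else 0)"
proof -
  define Q where "Q S \<longleftrightarrow> finite S \<and> v \<in> S \<and> (\<forall>x\<in>S. \<forall>y\<in>S. g x y = (if x = y then 1 else 0))" for S
  have "Suc n \<le> CARD('m) \<Longrightarrow> \<exists>S. Q S \<and> card S = Suc n" for n
  proof (induction n)
    case 0 have "Q {v}" using v by (simp add: Q_def)
    then show ?case by (intro exI[of _ "{v}"]) auto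
  next
    case (Suc n)
    then obtain S where S: "Q S" "card S = Suc n" by auto
    have fin: "finite S" using S by (simp add: Q_def)
    have "span S \<noteq> UNIV"
    proof
      assume "span S = UNIV"
      then have "dim (UNIV :: (real^'m) set) \<le> card S" using fin by (intro dim_le_card) auto
      then show False using Suc.prems S(2) by (simp add: dim_UNIV)
    qed
    then obtain x where x: "x \<notin> span S" by blast
    define y where "y = x - (\<Sum>s\<in>S. g x s *\<^sub>R s)"
    have "(\<Sum>s\<in>S. g x s *\<^sub>R s) \<in> span S" by (intro span_sum span_scale span_base)
    then have "y \<noteq> 0" using x by (auto simp: y_def)
    then have gy: "g y y > 0" by (rule pos)
    have gys: "g y s = 0" if s: "s \<in> S" for s
    proof -
      have "g y s = g x s - (\<Sum>t\<in>S. g x t * g t s)"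
        unfolding y_def using linear_diff[OF lin[of s]] linear_sum[OF lin[of s], of "\<lambda>s. g x s *\<^sub>R s" S] linear_cmul[OF lin[of s]] by simp
      also have "(\<Sum>t\<in>S. g x t * g t s) = (\<Sum>t\<in>S. if t = s then g x t else 0)"
        using S(1) s by (intro sum.cong) (auto simp: Q_def)
      also have "\<dots> = g x s" using fin s by simp
      finally show ?thesis by simp
    qed
    define z where "z = (1 / sqrt (g y y)) *\<^sub>R y"
    have gz: "g z u = (1 / sqrt (g y y)) * g y u" for u
      unfolding z_def using linear_cmul[OF lin[of u]] by simp
    have gzs: "g z s = 0" "g s z = 0" if "s \<in> S" for s using gys[OF that] gz sym[of s z] by auto
    have "g z z = (1 / sqrt (g y y)) * ((1 / sqrt (g y y)) * g y y)"
      using gz sym by metis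
    also have "\<dots> = 1" using gy by (simp add: divide_simps)
    finally have gzz: "g z z = 1" .
    have zS: "z \<notin> S" using gzs(1)[of z] gzz by auto
    have "Q (insert z S)" using S(1) gzs gzz zS unfolding Q_def by auto
    moreover have "card (insert z S) = Suc (Suc n)" using zS fin S(2) by simp
    ultimately show ?case by blast
  qed
  from this[of "CARD('m) - 1"] obtain S where S: "Q S" "card S = CARD('m)"
    using zero_less_card_finite[where 'a='m] by auto
  then obtain h where h: "bij_betw h (UNIV::'m set) S"
    using finite_same_card_bij[of "UNIV::'m set" S] by (auto simp: Q_def)
  have "v \<in> S" using S by (simp add: Q_def)
  then obtain k where "h k = v" using h by (metis bij_betw_imp_surj_on imageE)
  moreover have "g (h i) (h j) = (if i = j then 1 else 0)" for i j
  proof -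
    have "h i \<in> S" "h j \<in> S" using h bij_betwE by blast+
    moreover have "h i = h j \<longleftrightarrow> i = j" using h by (meson UNIV_I bij_betw_imp_inj_on inj_on_eq_iff)
    ultimately show ?thesis using S by (simp add: Q_def)
  qed
  ultimately show ?thesis using that by blast
qed

lemma metric_frame:
  fixes F :: "real^'m::finite \<Rightarrow> real"
  assumes F: "smooth F" and pos: "\<And>u. u \<noteq> 0 \<Longrightarrow> dd u (dd u F) x > 0" and q: "dd v (dd v F) x = 1"
  obtains e :: "'m \<Rightarrow> real^'m" and k where "e k = v" "\<And>i j. dd (e i) (dd (e j) F) x = (if i = j then 1 else 0)"
proof (rule orthonormal_basis_containing[of "\<lambda>u w. dd u (dd w F) x" v])
  show "linear (\<lambda>u. dd u (dd w F) x)" for w by (intro linear_dd smooth_dd F)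
  show "dd u (dd w F) x = dd w (dd u F) x" for u w using dd_commute[OF F, of u w] by simp
  show "dd u (dd u F) x > 0" if "u \<noteq> 0" for u by (rule pos[OF that])
qed (use q that in auto)

section \<open>The gradient estimate\<close>

text \<open>Here \<open>(x, v)\<close> maximises \<open>(DF v)\<^sup>2 (M - F)\<^sup>n / g(v,v)\<close>, normalised to \<open>g(v,v) = 1\<close>.
  Maximality in \<open>v\<close> makes \<open>p v\<close> the \<open>g\<close>-gradient of \<open>F\<close>, and maximality in \<open>x\<close> makes \<open>v\<close> an
  eigenvector of \<open>A = D\<^sup>3F(v,\<cdot>,\<cdot>)\<close> with eigenvalue \<open>l = 2/p - n p/\<eta>\<close>. The trace of \<open>A\<close>
  vanishes, so its part on the complement of \<open>v\<close> is \<open>-l\<close>, and by Cauchy--Schwarz the quadratic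
  term \<open>S\<close> in the sum of the second variations is at least \<open>l\<^sup>2/(n-1)\<close>. In terms of \<open>r = p\<^sup>2/\<eta>\<close>, the term \<open>(2 - n r)\<^sup>2/(n-1)\<close> obtained from \<open>S\<close> beats the negative
  term \<open>- n r\<^sup>2\<close> of the cutoff because the exponent \<open>n\<close> of the cutoff exceeds \<open>n - 1\<close>.
  Multiplying through by \<open>n - 1\<close> covers dimension one as well.\<close>

lemma gradient_bound_at_maximum:
  fixes F :: "real^'m::finite \<Rightarrow> real"
  assumes F: "smooth F" and ma: "\<And>x. det (hessian F x) = c"
    and pos: "\<And>x u. u \<noteq> 0 \<Longrightarrow> dd u (dd u F) x > 0"
    and n_def: "n = real CARD('m)"
    and \<eta>: "\<eta> = M - F x" "\<eta> > 0" and p: "dd v F x = p" "p > 0" and q: "dd v (dd v F) x = 1"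
    and mx: "\<And>y u. F y < M \<Longrightarrow> dd u F y > 0 \<Longrightarrow> dd u (dd u F) y > 0 \<Longrightarrow>
      2 * ln (dd u F y) - ln (dd u (dd u F) y) + n * ln (M - F y) \<le> 2 * ln p + n * ln \<eta>"
  shows "p\<^sup>2 \<le> (n\<^sup>2 + 3 * n) * \<eta>"
proof -
  have c: "dd a (dd b g) = dd b (dd a g)" if "smooth g" for a b g using dd_commute that by blast
  have test: "2 * ((dd y (dd v F) x + dd w F x) / p) - (dd y (dd v (dd v F)) x + 2 * dd v (dd w F) x) - n * (dd y F x / \<eta>) = 0"
    "2 * ((dd y (dd y (dd v F)) x + 2 * dd y (dd w F) x) / p - ((dd y (dd v F) x + dd w F x) / p)\<^sup>2)
      - ((dd y (dd y (dd v (dd v F))) x + 4 * dd y (dd v (dd w F)) x + 2 * dd w (dd w F) x) - (dd y (dd v (dd v F)) x + 2 * dd v (dd w F) x)\<^sup>2)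
      - n * (dd y (dd y F) x / \<eta> + (dd y F x / \<eta>)\<^sup>2) \<le> 0" for y w
  proof -
    note j = jet2_dd[OF F, of v w x y, unfolded p(1)] p(2) jet2_dd2[OF F, of v w x y, unfolded q] zero_less_one
      jet2_height[OF F, of M x y, folded \<eta>(1)] \<eta>(2)
    have m: "2 * ln (dd (v + s *\<^sub>R w) F (x + s *\<^sub>R y)) + (- 1 * ln (dd (v + s *\<^sub>R w) (dd (v + s *\<^sub>R w) F) (x + s *\<^sub>R y)) + n * ln (M - F (x + s *\<^sub>R y)))
      \<le> 2 * ln p + (- 1 * ln 1 + n * ln \<eta>)"
      if "dd (v + s *\<^sub>R w) F (x + s *\<^sub>R y) > 0" "dd (v + s *\<^sub>R w) (dd (v + s *\<^sub>R w) F) (x + s *\<^sub>R y) > 0" "M - F (x + s *\<^sub>R y) > 0" for s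
      using mx[of "x + s *\<^sub>R y" "v + s *\<^sub>R w"] that by simp
    note t = log_max_test[OF j m]
    show "2 * ((dd y (dd v F) x + dd w F x) / p) - (dd y (dd v (dd v F)) x + 2 * dd v (dd w F) x) - n * (dd y F x / \<eta>) = 0"
      using t(1) by simp
    show "2 * ((dd y (dd y (dd v F)) x + 2 * dd y (dd w F) x) / p - ((dd y (dd v F) x + dd w F x) / p)\<^sup>2)
      - ((dd y (dd y (dd v (dd v F))) x + 4 * dd y (dd v (dd w F)) x + 2 * dd w (dd w F) x) - (dd y (dd v (dd v F)) x + 2 * dd v (dd w F) x)\<^sup>2)
      - n * (dd y (dd y F) x / \<eta> + (dd y F x / \<eta>)\<^sup>2) \<le> 0"
      using t(2) by (simp add: algebra_simps)
  qed
  obtain e :: "'m \<Rightarrow> real^'m" and k where ek: "e k = v" and on: "\<And>i j. dd (e i) (dd (e j) F) x = (if i = j then 1 else 0)"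
    using metric_frame[OF F pos q] by metis
  have on_v: "dd (e i) (dd v F) x = (if i = k then 1 else 0)" "dd v (dd (e i) F) x = (if i = k then 1 else 0)" for i
    using on[of i k] on[of k i] by (auto simp: ek)
  define A where "A i j = dd v (dd (e i) (dd (e j) F)) x" for i j
  define T where "T i = dd v (dd v (dd (e i) (dd (e i) F))) x" for i
  define l where "l = 2 / p - n * (p / \<eta>)"
  have Asym: "A i j = A j i" for i j unfolding A_def using c[OF F, of "e i" "e j"] by simp
  note tr = monge_ampere_traces[OF F ma on, of v, folded A_def]
  have trA: "(\<Sum>i\<in>UNIV. A i i) = 0" using tr(1) .
  have trT: "(\<Sum>i\<in>UNIV. T i) = (\<Sum>i\<in>UNIV. \<Sum>j\<in>UNIV. (A i j)\<^sup>2)"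
    using tr(2) Asym by (simp add: T_def power2_eq_square)
  \<comment> \<open>First variations, in the vector alone and in the point alone.\<close>
  have D1: "dd w F x = p * dd v (dd w F) x" for w
    using test(1)[of 0 w] p(2) by (simp add: dd_zero_vec smooth_dd F field_simps)
  have D1e: "dd (e i) F x = (if i = k then p else 0)" for i using D1[of "e i"] on_v by simp
  have A3: "dd (e i) (dd v (dd v F)) x = A i k" for i
    unfolding A_def ek using c[OF smooth_dd[OF F], of "e i" v v] by simp
  have Ak: "A i k = (if i = k then l else 0)" for i
    using test(1)[of "e i" 0] A3[of i] on_v[of i] D1e[of i]
    by (auto simp: dd2_zero_vec dd_zero_vec smooth_dd F l_def split: if_splits)
  have Ak': "A k i = (if i = k then l else 0)" for i using Ak Asym by metis
  have T4: "dd (e i) (dd (e i) (dd v (dd v F))) x = T i" for i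
    unfolding T_def using F by (simp only: c[of _ "e i" v] smooth_dd)
  \<comment> \<open>Along \<open>v\<close> itself the vector stays fixed: moving it in its own direction only rescales it.\<close>
  have ineq_k: "2 * (l / p - 1 / p\<^sup>2) - (T k - l\<^sup>2) - n * (1 / \<eta> + p\<^sup>2 / \<eta>\<^sup>2) \<le> 0"
    using test(2)[of v 0] T4[of k] A3[of k] Ak[of k]
    by (simp add: ek dd_zero_fun dd_const smooth_dd F q p(1) power_divide)
  have ineq: "2 / p\<^sup>2 - 2 * A a a / p - T a + 2 * (\<Sum>b\<in>UNIV. (A a b)\<^sup>2) - n / \<eta> \<le> 0" if a: "a \<noteq> k" for a
  proof -
    \<comment> \<open>The vector \<open>e\<^sub>a/p - A e\<^sub>a\<close> is the change of the gradient direction along \<open>e\<^sub>a\<close>; it makes the sum of second variations largest.\<close>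
    define C where "C b = (if b = a then 1 / p else 0) - A a b" for b
    define w where "w = (\<Sum>b\<in>UNIV. C b *\<^sub>R e b)"
    have Ck: "C k = 0" using a Ak[of a] by (simp add: C_def)
    have CA: "(\<Sum>b\<in>UNIV. C b * A a b) = A a a / p - (\<Sum>b\<in>UNIV. (A a b)\<^sup>2)"
      unfolding C_def left_diff_distrib sum_subtractf power2_eq_square
      by (simp add: if_distrib if_distribR cong: if_cong)
    have CC: "(\<Sum>b\<in>UNIV. C b * C b) = 1 / p\<^sup>2 - 2 * (A a a / p) + (\<Sum>b\<in>UNIV. (A a b)\<^sup>2)"
    proof -
      have "C b * C b = (if b = a then 1 / p\<^sup>2 - 2 * (A a a / p) else 0) + (A a b)\<^sup>2" for b
        by (simp add: C_def power2_eq_square algebra_simps)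
      then show ?thesis by (simp add: sum.distrib)
    qed
    have w1: "dd w F x = 0" "dd v (dd w F) x = 0"
      unfolding w_def by (simp_all add: dd_sum_vec dd2_sum_vec smooth_dd F D1e on_v Ck if_distrib cong: if_cong)
    have w2: "dd (e a) (dd w F) x = 1 / p - A a a"
      unfolding w_def by (simp add: dd2_sum_vec smooth_dd F on if_distrib cong: if_cong) (simp add: C_def)
    have w3: "dd w (dd w F) x = (\<Sum>b\<in>UNIV. C b * C b)"
    proof -
      have "dd (e b) (dd w F) x = C b" for b
        unfolding w_def by (simp add: dd2_sum_vec smooth_dd F on if_distrib cong: if_cong)
      then show ?thesis using dd_sum_vec[OF smooth_dd[OF F, of w], of C e UNIV x, folded w_def] by simp
    qed
    have w4: "dd (e a) (dd v (dd w F)) x = (\<Sum>b\<in>UNIV. C b * A a b)"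
    proof -
      have "dd (e a) (dd v (dd w F)) = dd w (dd v (dd (e a) F))"
        by (simp only: c[OF F, of v w] c[OF smooth_dd[OF F], of "e a" w] c[OF F, of "e a" v])
      then have e1: "dd (e a) (dd v (dd w F)) x = (\<Sum>b\<in>UNIV. C b * dd (e b) (dd v (dd (e a) F)) x)"
        unfolding w_def by (simp only: dd_sum_vec smooth_dd F)
      have "dd (e b) (dd v (dd (e a) F)) x = A a b" for b
        using c[OF smooth_dd[OF F], of "e b" v "e a"] Asym[of a b] by (simp add: A_def)
      then show ?thesis by (simp only: e1)
    qed
    have A2: "dd (e a) (dd (e a) (dd v F)) x = A a a"
      unfolding A_def using F by (simp only: c[of _ "e a" v] smooth_dd)
    have "2 * (A a a + 2 * (1 / p - A a a)) / p - (T a + 4 * (A a a / p - (\<Sum>b\<in>UNIV. (A a b)\<^sup>2))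
        + 2 * (1 / p\<^sup>2 - 2 * (A a a / p) + (\<Sum>b\<in>UNIV. (A a b)\<^sup>2))) - n / \<eta> \<le> 0"
      using test(2)[of "e a" w] A3[of a] Ak[of a] a
      by (simp add: A2 w1 w2 w3 w4 T4 CA CC on D1e on_v)
    then show ?thesis by (simp add: algebra_simps power2_eq_square add_divide_distrib diff_divide_distrib)
  qed
  let ?U = "UNIV - {k}"
  have n1: "real (card ?U) = n - 1" using n_def by (simp add: card_Diff_singleton of_nat_diff)
  define S where "S = (\<Sum>a\<in>?U. \<Sum>b\<in>UNIV. (A a b)\<^sup>2)"
  have split: "(\<Sum>a\<in>UNIV. f a) = f k + (\<Sum>a\<in>?U. f a)" for f :: "'m \<Rightarrow> real"
    by (simp add: sum.remove[of UNIV k])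
  have Akk: "(\<Sum>b\<in>UNIV. (A k b)\<^sup>2) = l\<^sup>2" by (simp add: Ak' if_distrib[of "\<lambda>z. z\<^sup>2"] cong: if_cong)
  have sA: "(\<Sum>a\<in>?U. A a a) = - l" using trA split[of "\<lambda>a. A a a"] Ak[of k] by simp
  have sT: "T k + (\<Sum>a\<in>?U. T a) = l\<^sup>2 + S" using trT split[of T] split[of "\<lambda>a. \<Sum>b\<in>UNIV. (A a b)\<^sup>2"] Akk by (simp add: S_def)
  have "(\<Sum>a\<in>?U. 2 / p\<^sup>2 - 2 * A a a / p - T a + 2 * (\<Sum>b\<in>UNIV. (A a b)\<^sup>2) - n / \<eta>) \<le> 0"
    using ineq by (intro sum_nonpos) auto
  then have sum1: "(n - 1) * (2 / p\<^sup>2) + 2 * l / p - (\<Sum>a\<in>?U. T a) + 2 * S - (n - 1) * (n / \<eta>) \<le> 0"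
    using sA by (simp add: sum_subtractf sum.distrib n_def S_def sum_distrib_left[symmetric] sum_divide_distrib[symmetric])
  have J: "2 * (n - 1) / p\<^sup>2 + 4 * l / p - 2 / p\<^sup>2 + S - n\<^sup>2 / \<eta> - n * p\<^sup>2 / \<eta>\<^sup>2 \<le> 0"
  proof -
    define X Y Z W where "X = 1 / p\<^sup>2" and "Y = l / p" and "Z = 1 / \<eta>" and "W = p\<^sup>2 / \<eta>\<^sup>2"
    have 1: "(n - 1) * (2 * X) + 2 * Y - (\<Sum>a\<in>?U. T a) + 2 * S - (n - 1) * (n * Z) \<le> 0"
      using sum1 by (simp add: X_def Y_def Z_def)
    have 2: "2 * (Y - X) - (T k - l\<^sup>2) - n * (Z + W) \<le> 0"
      using ineq_k by (simp add: X_def Y_def Z_def W_def)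
    have "2 * (n - 1) * X + 4 * Y - 2 * X + S - n\<^sup>2 * Z - n * W \<le> 0"
      using 1 2 sT by (simp add: algebra_simps power2_eq_square)
    then show ?thesis by (simp add: X_def Y_def Z_def W_def)
  qed
  have "l\<^sup>2 = (\<Sum>a\<in>?U. A a a * 1)\<^sup>2" using sA by simp
  also have "\<dots> \<le> (\<Sum>a\<in>?U. (A a a)\<^sup>2) * (\<Sum>a\<in>?U. 1\<^sup>2)" by (rule Cauchy_Schwarz_ineq_sum)
  also have "\<dots> = (\<Sum>a\<in>?U. (A a a)\<^sup>2) * (n - 1)" using n1 by simp
  also have "\<dots> \<le> S * (n - 1)"
  proof (rule mult_right_mono)
    have "(A a a)\<^sup>2 \<le> (\<Sum>b\<in>UNIV. (A a b)\<^sup>2)" for a by (rule member_le_sum) auto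
    then show "(\<Sum>a\<in>?U. (A a a)\<^sup>2) \<le> S" unfolding S_def by (intro sum_mono)
    show "0 \<le> n - 1" using n1 by (metis of_nat_0_le_iff)
  qed
  finally have lS: "l\<^sup>2 \<le> S * (n - 1)" .
  have n: "n \<ge> 1" using n1 of_nat_0_le_iff[of "card ?U"] by linarith
  define r where "r = p\<^sup>2 / \<eta>"
  have r: "r > 0" using p \<eta> by (simp add: r_def)
  have pl: "p * l = 2 - n * r" using p(2) by (simp add: l_def r_def field_simps power2_eq_square)
  have "p\<^sup>2 * (2 * (n - 1) / p\<^sup>2 + 4 * l / p - 2 / p\<^sup>2 + S - n\<^sup>2 / \<eta> - n * p\<^sup>2 / \<eta>\<^sup>2) \<le> 0"
    using J p(2) by (simp add: mult_le_0_iff)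
  moreover have "p\<^sup>2 * (2 * (n - 1) / p\<^sup>2 + 4 * l / p - 2 / p\<^sup>2 + S - n\<^sup>2 / \<eta> - n * p\<^sup>2 / \<eta>\<^sup>2)
    = 2 * (n - 1) + 4 * (p * l) - 2 + p\<^sup>2 * S - n\<^sup>2 * r - n * r\<^sup>2"
    using p(2) \<eta>(2) by (simp add: r_def field_simps power2_eq_square)
  ultimately have J2: "2 * (n - 1) + 4 * (2 - n * r) - 2 + p\<^sup>2 * S - n\<^sup>2 * r - n * r\<^sup>2 \<le> 0" by (simp add: pl)
  have "(2 - n * r)\<^sup>2 \<le> (n - 1) * (p\<^sup>2 * S)"
    using mult_left_mono[OF lS, of "p\<^sup>2"] by (simp add: pl[symmetric] power_mult_distrib mult_ac)
  moreover have "(n - 1) * (2 * (n - 1) + 4 * (2 - n * r) - 2 + p\<^sup>2 * S - n\<^sup>2 * r - n * r\<^sup>2) \<le> 0"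
    using J2 n by (simp add: mult_le_0_iff)
  ultimately have "(n - 1) * (2 * (n - 1) + 4 * (2 - n * r) - 2 - n\<^sup>2 * r - n * r\<^sup>2) + (2 - n * r)\<^sup>2 \<le> 0"
    by (simp add: algebra_simps)
  then have "(n - 1) * (2 * n + 4) + 4 + n * (r * (r - (n\<^sup>2 + 3 * n))) \<le> 0"
    by (simp add: algebra_simps power2_eq_square)
  moreover have "(n - 1) * (2 * n + 4) \<ge> 0" using n by simp
  ultimately have "n * (r * (r - (n\<^sup>2 + 3 * n))) \<le> 0" by linarith
  then have "r \<le> n\<^sup>2 + 3 * n" using n r by (simp add: mult_le_0_iff)
  then show ?thesis using \<eta>(2) by (simp add: r_def field_simps)
qed

text \<open>Degree-zero homogeneity in the vector reduces the search to the compact unit sphere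
  and turns the maximum over the sphere into one over all nonzero vectors, so that the vector can be
  varied freely at the maximum.\<close>

lemma homogeneous_max:
  fixes f :: "'a::t2_space \<Rightarrow> 'b::euclidean_space \<Rightarrow> real"
  assumes K: "compact K" and cont: "continuous_on (K \<times> sphere 0 1) (\<lambda>z. f (fst z) (snd z))"
    and hom: "\<And>x u r. x \<in> K \<Longrightarrow> u \<noteq> 0 \<Longrightarrow> r > 0 \<Longrightarrow> f x (r *\<^sub>R u) = f x u"
    and ne: "x1 \<in> K" "u1 \<noteq> 0"
  obtains x0 v0 where "x0 \<in> K" "v0 \<noteq> 0" "\<And>x u. x \<in> K \<Longrightarrow> u \<noteq> 0 \<Longrightarrow> f x u \<le> f x0 v0"
proof -
  have nrm: "f x (u /\<^sub>R norm u) = f x u" "u /\<^sub>R norm u \<in> sphere 0 1" if "x \<in> K" "u \<noteq> 0" for x u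
    using hom[of x u "inverse (norm u)"] that by auto
  have "compact (K \<times> sphere (0::'b) 1)" by (intro compact_Times K compact_sphere)
  moreover have "K \<times> sphere (0::'b) 1 \<noteq> {}" using ne nrm(2) by blast
  ultimately obtain z where z: "z \<in> K \<times> sphere 0 1"
    "\<And>y. y \<in> K \<times> sphere 0 1 \<Longrightarrow> f (fst y) (snd y) \<le> f (fst z) (snd z)"
    using continuous_attains_sup[OF _ _ cont] by blast
  show ?thesis
  proof (rule that[of "fst z" "snd z"])
    show "fst z \<in> K" "snd z \<noteq> 0" using z(1) by auto
    show "f x u \<le> f (fst z) (snd z)" if xu: "x \<in> K" "u \<noteq> 0" for x u
      using z(2)[of "(x, u /\<^sub>R norm u)"] nrm[OF xu] xu by auto
  qed
qed

lemma gradient_estimate: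
  fixes F :: "real^'m::finite \<Rightarrow> real"
  assumes F: "smooth F" and ma: "\<And>x. det (hessian F x) = c"
    and pos: "\<And>x u. u \<noteq> 0 \<Longrightarrow> dd u (dd u F) x > 0"
    and nonneg: "\<And>x. F x \<ge> 0" and K: "compact {x. F x \<le> M}"
    and n_def: "n = CARD('m)" and x: "F x \<le> M"
  shows "(dd u F x)\<^sup>2 * (M - F x) ^ n \<le> ((real n)\<^sup>2 + 3 * real n) * M ^ Suc n * dd u (dd u F) x"
proof -
  define f where "f x u = (dd u F x)\<^sup>2 * (M - F x) ^ n / dd u (dd u F) x" for x u
  let ?C = "(real n)\<^sup>2 + 3 * real n"
  have n: "n > 0" by (simp add: n_def)
  have M: "M \<ge> 0" using nonneg x order_trans by blast
  show ?thesis
  proof (cases "dd u F x = 0 \<or> F x = M")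
    case True
    have "dd u (dd u F) x \<ge> 0" using pos[of u x] by (cases "u = 0") (auto simp: dd_zero_vec smooth_dd F intro: less_imp_le)
    then have "0 \<le> ?C * M ^ Suc n * dd u (dd u F) x"
      using M by (intro mult_nonneg_nonneg zero_le_power add_nonneg_nonneg) auto
    moreover have "(dd u F x)\<^sup>2 * (M - F x) ^ n = 0" using True n by auto
    ultimately show ?thesis by linarith
  next
    case False
    have u: "u \<noteq> 0" using False by (auto simp: dd_zero_vec F)
    have qne: "dd y (dd y F) x \<noteq> 0" if "norm y = 1" for x y using pos[of y x] that norm_zero by fastforce
  have cont: "continuous_on ({x. F x \<le> M} \<times> sphere 0 1) (\<lambda>z. f (fst z) (snd z))"
      unfolding f_def
      by (intro continuous_intros continuous_dd1 continuous_dd2 F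
          continuous_on_compose2[OF smooth_continuous_on[OF F, of UNIV]])
        (auto simp: qne)
    have hom: "f x (r *\<^sub>R u) = f x u" if "r \<noteq> 0" for x u r
      using that by (simp add: f_def dd2_scale dd_scaleR_vec F power_mult_distrib)
    obtain x0 v0 where x0: "F x0 \<le> M" "v0 \<noteq> 0" and mx: "\<And>x u. F x \<le> M \<Longrightarrow> u \<noteq> 0 \<Longrightarrow> f x u \<le> f x0 v0"
      using homogeneous_max[OF K cont, of x u] hom x u by auto
    have "f x u > 0" using False x pos[OF u, of x] by (simp add: f_def)
    then have f0: "f x0 v0 > 0" using mx[OF x u] by linarith
    have q0: "dd v0 (dd v0 F) x0 > 0" using pos x0(2) by blast
    have ne: "dd v0 F x0 \<noteq> 0" "M - F x0 \<noteq> 0" using f0 n by (auto simp: f_def zero_power)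
    define \<eta> where "\<eta> = M - F x0"
    have \<eta>: "\<eta> > 0" using ne(2) x0(1) by (simp add: \<eta>_def)
    define r where "r = sgn (dd v0 F x0) / sqrt (dd v0 (dd v0 F) x0)"
    have r: "r \<noteq> 0" using ne q0 by (simp add: r_def sgn_zero_iff)
    define v where "v = r *\<^sub>R v0"
    define p where "p = dd v F x0"
    have "p = \<bar>dd v0 F x0\<bar> / sqrt (dd v0 (dd v0 F) x0)"
      by (simp add: p_def v_def dd_scaleR_vec F r_def abs_sgn mult.commute)
    then have p: "p > 0" using ne q0 by simp
    have q: "dd v (dd v F) x0 = 1"
      using ne q0 by (simp add: v_def dd2_scale F r_def power_divide sgn_if)
    have fv: "f x0 v0 = p\<^sup>2 * \<eta> ^ n"
      using hom[OF r, of x0 v0] by (simp add: f_def v_def[symmetric] q p_def \<eta>_def)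
    have lnmx: "2 * ln (dd u F y) - ln (dd u (dd u F) y) + real n * ln (M - F y) \<le> 2 * ln p + real n * ln \<eta>"
      if y: "F y < M" "dd u F y > 0" "dd u (dd u F) y > 0" for y u
    proof -
      have u: "u \<noteq> 0" using y(2) by (auto simp: dd_zero_vec F)
      have "ln (f y u) \<le> ln (p\<^sup>2 * \<eta> ^ n)" using mx[of y u] y u fv p \<eta> by (simp add: f_def)
      moreover have "ln (f y u) = 2 * ln (dd u F y) - ln (dd u (dd u F) y) + real n * ln (M - F y)"
        using y by (simp add: f_def ln_div ln_mult ln_realpow)
      moreover have "ln (p\<^sup>2 * \<eta> ^ n) = 2 * ln p + real n * ln \<eta>"
        using p \<eta> by (simp add: ln_mult ln_realpow)
      ultimately show ?thesis by linarith
    qed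
    have "p\<^sup>2 \<le> ?C * \<eta>"
      by (rule gradient_bound_at_maximum[OF F ma pos _ \<eta>_def \<eta> p_def[symmetric] p q lnmx]) (simp_all add: n_def)
    then have "p\<^sup>2 * \<eta> ^ n \<le> ?C * \<eta> * \<eta> ^ n" using \<eta> by (intro mult_right_mono) auto
    also have "\<dots> = ?C * \<eta> ^ Suc n" by simp
    also have "\<dots> \<le> ?C * M ^ Suc n" using nonneg[of x0] \<eta>
      by (intro mult_left_mono power_mono) (auto simp: \<eta>_def)
    finally have "f x u \<le> ?C * M ^ Suc n" using mx[OF x u] fv by linarith
    then show ?thesis using pos[OF u, of x] by (simp add: f_def divide_le_eq)
  qed
qed

section \<open>The estimate of the third derivatives\<close>

text \<open>Here \<open>(x, v)\<close> maximises \<open>D\<^sup>3F(v,v,v) (M - F) / g(v,v)\<^sup>3\<^sup>/\<^sup>2\<close>, normalised to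
  \<open>g(v,v) = 1\<close>. Write \<open>A = D\<^sup>3F(v,\<cdot>,\<cdot>)\<close>. First variation in the vector gives \<open>A v = l v\<close>; second
  variation in the vector gives \<open>A \<le> l/2\<close> on the complement of \<open>v\<close>. Moving the vector along \<open>e\<^sub>a\<close> by
  \<open>- A e\<^sub>a / 2\<close> is parallel transport for the Levi-Civita connection of \<open>g\<close>, to first order. It
  makes the fourth derivatives cancel in the sum of the second variations and
  leaves \<open>3/4 tr A\<^sup>2 - tr A\<^sup>3 / (2 l)\<close>, to which \<open>v\<close> contributes \<open>l\<^sup>2/4\<close> and every other direction a
  nonnegative amount. The cutoff costs \<open>2 P/\<eta>\<^sup>2 + n/\<eta>\<close>, where \<open>P \<le> B\<close> is the squared
  gradient.\<close>

lemma cubic_bound_at_maximum: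
  fixes F :: "real^'m::finite \<Rightarrow> real"
  assumes F: "smooth F" and ma: "\<And>x. det (hessian F x) = c"
    and pos: "\<And>x u. u \<noteq> 0 \<Longrightarrow> dd u (dd u F) x > 0"
    and n_def: "n = real CARD('m)"
    and \<eta>: "\<eta> = M - F x" "\<eta> > 0" and l: "dd v (dd v (dd v F)) x = l" "l > 0" and q: "dd v (dd v F) x = 1"
    and B: "\<And>u. (dd u F x)\<^sup>2 \<le> B * dd u (dd u F) x"
    and mx: "\<And>y u. F y < M \<Longrightarrow> dd u (dd u (dd u F)) y > 0 \<Longrightarrow> dd u (dd u F) y > 0 \<Longrightarrow>
      ln (dd u (dd u (dd u F)) y) - 3 / 2 * ln (dd u (dd u F) y) + ln (M - F y) \<le> ln l + ln \<eta>"
  shows "l\<^sup>2 * \<eta>\<^sup>2 \<le> 8 * B + 4 * n * \<eta>"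
proof -
  have c: "dd a (dd b g) = dd b (dd a g)" if "smooth g" for a b g using dd_commute that by blast
  have test: "(dd y (dd v (dd v (dd v F))) x + 3 * dd v (dd v (dd w F)) x) / l
      - 3 / 2 * (dd y (dd v (dd v F)) x + 2 * dd v (dd w F) x) - dd y F x / \<eta> = 0"
    "(dd y (dd y (dd v (dd v (dd v F)))) x + 6 * dd y (dd v (dd v (dd w F))) x + 6 * dd v (dd w (dd w F)) x) / l
       - ((dd y (dd v (dd v (dd v F))) x + 3 * dd v (dd v (dd w F)) x) / l)\<^sup>2
      - 3 / 2 * ((dd y (dd y (dd v (dd v F))) x + 4 * dd y (dd v (dd w F)) x + 2 * dd w (dd w F) x)
          - (dd y (dd v (dd v F)) x + 2 * dd v (dd w F) x)\<^sup>2)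
      - (dd y (dd y F) x / \<eta> + (dd y F x / \<eta>)\<^sup>2) \<le> 0" for y w
  proof -
    note j = jet2_dd3[OF F, of v w x y, unfolded l(1)] l(2) jet2_dd2[OF F, of v w x y, unfolded q] zero_less_one
      jet2_height[OF F, of M x y, folded \<eta>(1)] \<eta>(2)
    have m: "1 * ln (dd (v + s *\<^sub>R w) (dd (v + s *\<^sub>R w) (dd (v + s *\<^sub>R w) F)) (x + s *\<^sub>R y))
        + (- (3 / 2) * ln (dd (v + s *\<^sub>R w) (dd (v + s *\<^sub>R w) F) (x + s *\<^sub>R y)) + 1 * ln (M - F (x + s *\<^sub>R y)))
      \<le> 1 * ln l + (- (3 / 2) * ln 1 + 1 * ln \<eta>)"
      if "dd (v + s *\<^sub>R w) (dd (v + s *\<^sub>R w) (dd (v + s *\<^sub>R w) F)) (x + s *\<^sub>R y) > 0"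
        "dd (v + s *\<^sub>R w) (dd (v + s *\<^sub>R w) F) (x + s *\<^sub>R y) > 0" "M - F (x + s *\<^sub>R y) > 0" for s
      using mx[of "x + s *\<^sub>R y" "v + s *\<^sub>R w"] that by simp
    note t = log_max_test[OF j m]
    show "(dd y (dd v (dd v (dd v F))) x + 3 * dd v (dd v (dd w F)) x) / l
      - 3 / 2 * (dd y (dd v (dd v F)) x + 2 * dd v (dd w F) x) - dd y F x / \<eta> = 0"
      using t(1) by simp
    show "(dd y (dd y (dd v (dd v (dd v F)))) x + 6 * dd y (dd v (dd v (dd w F))) x + 6 * dd v (dd w (dd w F)) x) / l
       - ((dd y (dd v (dd v (dd v F))) x + 3 * dd v (dd v (dd w F)) x) / l)\<^sup>2
      - 3 / 2 * ((dd y (dd y (dd v (dd v F))) x + 4 * dd y (dd v (dd w F)) x + 2 * dd w (dd w F) x)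
          - (dd y (dd v (dd v F)) x + 2 * dd v (dd w F) x)\<^sup>2)
      - (dd y (dd y F) x / \<eta> + (dd y F x / \<eta>)\<^sup>2) \<le> 0"
      using t(2) by simp
  qed
  obtain e :: "'m \<Rightarrow> real^'m" and k where ek: "e k = v" and on: "\<And>i j. dd (e i) (dd (e j) F) x = (if i = j then 1 else 0)"
    using metric_frame[OF F pos q] by metis
  have on_v: "dd v (dd (e i) F) x = (if i = k then 1 else 0)" for i
    using on[of k i] by (auto simp: ek)
  define A where "A i j = dd v (dd (e i) (dd (e j) F)) x" for i j
  define T where "T i j = dd v (dd v (dd (e i) (dd (e j) F))) x" for i j
  define R where "R i = dd v (dd v (dd v (dd (e i) (dd (e i) F)))) x" for i
  define N where "N i = (\<Sum>j\<in>UNIV. (A i j)\<^sup>2)" for i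
  define Q where "Q i = (\<Sum>j\<in>UNIV. \<Sum>h\<in>UNIV. A i j * (A i h * A j h))" for i
  define d where "d i = dd (e i) F x" for i
  have Asym: "A i j = A j i" for i j unfolding A_def using c[OF F, of "e i" "e j"] by simp
  have Tsym: "T i j = T j i" for i j unfolding T_def using c[OF F, of "e i" "e j"] by simp
  note tr = monge_ampere_traces[OF F ma on, of v, folded A_def, folded T_def]
  have trT: "(\<Sum>i\<in>UNIV. T i i) = (\<Sum>i\<in>UNIV. N i)"
    using tr(2) Asym by (simp add: N_def power2_eq_square)
  have trR: "(\<Sum>i\<in>UNIV. R i) = 3 * (\<Sum>i\<in>UNIV. \<Sum>j\<in>UNIV. A i j * T i j) - 2 * (\<Sum>i\<in>UNIV. Q i)"
  proof -
    have "A i h * A h j * A j i = A i j * (A i h * A j h)" for i j h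
      using Asym[of h j] Asym[of j i] by simp
    then have "(\<Sum>i\<in>UNIV. \<Sum>j\<in>UNIV. \<Sum>h\<in>UNIV. A i h * A h j * A j i) = (\<Sum>i\<in>UNIV. Q i)"
      unfolding Q_def by (intro sum.cong refl)
    moreover have "A i j * T j i = A i j * T i j" for i j using Tsym[of i j] by simp
    then have "(\<Sum>i\<in>UNIV. \<Sum>j\<in>UNIV. A i j * T j i) = (\<Sum>i\<in>UNIV. \<Sum>j\<in>UNIV. A i j * T i j)"
      by (intro sum.cong refl)
    ultimately show ?thesis using tr(3) by (simp only: R_def)
  qed
  have A3: "dd (e i) (dd v (dd v F)) x = A i k" for i
    unfolding A_def ek using c[OF smooth_dd[OF F], of "e i" v v] by simp
  have D3: "dd v (dd v (dd w F)) x = l * dd v (dd w F) x" for w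
    using test(1)[of 0 w] l(2) by (simp add: dd_zero_vec smooth_dd F field_simps)
  have Ak: "A i k = (if i = k then l else 0)" for i
    using D3[of "e i"] on_v[of i] c[OF F, of v "e i"] by (simp add: A_def ek)
  have Ak': "A k i = (if i = k then l else 0)" for i using Ak Asym by metis
  have half: "dd v (dd w (dd w F)) x \<le> l / 2 * dd w (dd w F) x" if "dd v (dd w F) x = 0" for w
    using test(2)[of 0 w] D3[of w] that l(2) by (simp add: dd_zero_vec smooth_dd F field_simps)
  have comb: "dd v (dd w F) x = C k" "dd w (dd w F) x = (\<Sum>b\<in>UNIV. (C b)\<^sup>2)"
    "dd v (dd w (dd w F)) x = (\<Sum>b\<in>UNIV. \<Sum>h\<in>UNIV. C b * (C h * A b h))"
    "dd (e a) (dd v (dd w F)) x = (\<Sum>b\<in>UNIV. C b * A a b)"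
    "dd (e a) (dd v (dd v (dd w F))) x = (\<Sum>b\<in>UNIV. C b * T a b)"
    if w: "w = (\<Sum>b\<in>UNIV. C b *\<^sub>R e b)" for w C a
  proof -
    show "dd v (dd w F) x = C k"
      unfolding w by (simp add: dd2_sum_vec smooth_dd F on_v if_distrib cong: if_cong)
    have "dd (e b) (dd w F) x = C b" for b
      unfolding w by (simp add: dd2_sum_vec smooth_dd F on if_distrib cong: if_cong)
    then show "dd w (dd w F) x = (\<Sum>b\<in>UNIV. (C b)\<^sup>2)"
      using dd_sum_vec[OF smooth_dd[OF F, of w], of C e UNIV x, folded w] by (simp add: power2_eq_square)
    have s: "dd w g x = (\<Sum>b\<in>UNIV. C b * dd (e b) g x)" if "smooth g" for g
      unfolding w using that by (rule dd_sum_vec)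
    have 1: "dd (e a) (dd v (dd w F)) = dd w (dd v (dd (e a) F))" for a
      by (simp only: c[OF F, of v w] c[OF smooth_dd[OF F], of "e a" w] c[OF F, of "e a" v])
    have 2: "dd (e b) (dd v (dd (e a) F)) x = A a b" for a b
      using c[OF smooth_dd[OF F], of "e b" v "e a"] Asym[of a b] by (simp add: A_def)
    show 3: "dd (e a) (dd v (dd w F)) x = (\<Sum>b\<in>UNIV. C b * A a b)" for a
      unfolding 1 by (simp add: s smooth_dd F 2)
    have "dd v (dd w (dd w F)) = dd w (dd v (dd w F))" by (rule c[OF smooth_dd[OF F]])
    then show "dd v (dd w (dd w F)) x = (\<Sum>b\<in>UNIV. \<Sum>h\<in>UNIV. C b * (C h * A b h))"
      by (simp add: s smooth_dd F 3 sum_distrib_left)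
    have "dd (e a) (dd v (dd v (dd w F))) = dd w (dd v (dd v (dd (e a) F)))"
      by (simp only: c[OF F, of v w] c[OF smooth_dd[OF F], of v w] c[OF smooth_dd[OF smooth_dd[OF F]], of "e a" w]
          c[OF smooth_dd[OF F], of "e a" v] c[OF F, of "e a" v])
    moreover have "dd (e b) (dd v (dd v (dd (e a) F))) x = T a b" for b
      using Tsym[of a b] by (simp only: c[OF smooth_dd[OF smooth_dd[OF F]], of "e b" v] c[OF smooth_dd[OF F], of "e b" v] T_def)
    ultimately show "dd (e a) (dd v (dd v (dd w F))) x = (\<Sum>b\<in>UNIV. C b * T a b)"
      by (simp add: s smooth_dd F)
  qed
  have T4: "dd (e i) (dd (e i) (dd v (dd v F))) x = T i i" for i
    unfolding T_def using F by (simp only: c[of _ "e i" v] smooth_dd)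
  have R5: "dd (e i) (dd (e i) (dd v (dd v (dd v F)))) x = R i" for i
    unfolding R_def using F by (simp only: c[of _ "e i" v] smooth_dd)
  have ineq: "(R a - 3 * (\<Sum>b\<in>UNIV. A a b * T a b) + 3 / 2 * Q a) / l - 2 * ((d a)\<^sup>2 / \<eta>\<^sup>2)
     - 3 / 2 * (T a a - 3 / 2 * N a) - 1 / \<eta> \<le> 0" for a
  proof -
    \<comment> \<open>Parallel transport of \<open>v\<close> along \<open>e\<^sub>a\<close>.\<close>
    define w where "w = (\<Sum>b\<in>UNIV. (- A a b / 2) *\<^sub>R e b)"
    note cw = comb[OF w_def]
    have q1: "dd (e a) (dd v (dd v F)) x + 2 * dd v (dd w F) x = 0"
      unfolding A3 cw(1) by simp
    have t1: "(dd (e a) (dd v (dd v (dd v F))) x + 3 * dd v (dd v (dd w F)) x) / l = d a / \<eta>"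
      using test(1)[of "e a" w] unfolding q1 d_def by simp
    have v1: "dd (e a) (dd v (dd v (dd w F))) x = - (\<Sum>b\<in>UNIV. A a b * T a b) / 2"
      unfolding cw(5) by (simp add: sum_negf sum_divide_distrib)
    have v2: "dd v (dd w (dd w F)) x = Q a / 4"
      unfolding cw(3) Q_def by (simp add: sum_divide_distrib)
    have v3: "dd (e a) (dd v (dd w F)) x = - N a / 2"
      unfolding cw(4) N_def by (simp add: sum_negf sum_divide_distrib power2_eq_square)
    have v4: "dd w (dd w F) x = N a / 4"
      unfolding cw(2) N_def by (simp add: sum_divide_distrib power2_eq_square)
    show ?thesis
      using test(2)[of "e a" w] unfolding q1 t1 v1 v2 v3 v4 T4 R5 d_def[symmetric]
      by (simp add: on power_divide)
  qed
  have QN: "Q a \<le> l / 2 * N a" if "a \<noteq> k" for a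
    using half[of "\<Sum>b\<in>UNIV. A a b *\<^sub>R e b"] comb(1-3)[OF refl, of "A a"] Ak[of a] that
    by (simp add: Q_def N_def)
  have Nk: "N k = l\<^sup>2" unfolding N_def by (simp add: Ak' if_distrib[of "\<lambda>z. z\<^sup>2"] cong: if_cong)
  have Qk: "Q k = l * l\<^sup>2"
  proof -
    have "A k j * (A k h * A j h) = (if h = k then if j = k then l * l\<^sup>2 else 0 else 0)" for j h
      using Ak'[of j] Ak'[of h] by (auto simp: power2_eq_square)
    then show ?thesis by (simp add: Q_def)
  qed
  have Npos: "N a \<ge> 0" for a by (simp add: N_def sum_nonneg)
  define P where "P = (\<Sum>a\<in>UNIV. (d a)\<^sup>2)"
  have "(\<Sum>a\<in>UNIV. (R a - 3 * (\<Sum>b\<in>UNIV. A a b * T a b) + 3 / 2 * Q a) / l - 2 * ((d a)\<^sup>2 / \<eta>\<^sup>2)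
     - 3 / 2 * (T a a - 3 / 2 * N a) - 1 / \<eta>) \<le> 0"
    using ineq by (intro sum_nonpos) auto
  then have "((\<Sum>a\<in>UNIV. R a) - 3 * (\<Sum>a\<in>UNIV. \<Sum>b\<in>UNIV. A a b * T a b) + 3 / 2 * (\<Sum>a\<in>UNIV. Q a)) / l
     - 2 * (P / \<eta>\<^sup>2) - 3 / 2 * ((\<Sum>a\<in>UNIV. T a a) - 3 / 2 * (\<Sum>a\<in>UNIV. N a)) - n / \<eta> \<le> 0"
    by (simp only: P_def sum_subtractf sum.distrib sum_distrib_left[symmetric] sum_divide_distrib[symmetric])
      (simp add: n_def)
  then have main: "3 / 4 * (\<Sum>a\<in>UNIV. N a) - (\<Sum>a\<in>UNIV. Q a) / (2 * l) \<le> 2 * (P / \<eta>\<^sup>2) + n / \<eta>"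
    unfolding trR trT by (simp add: diff_divide_distrib add_divide_distrib)
  have "l\<^sup>2 / 4 = 3 / 4 * N k - Q k / (2 * l)" using l(2) by (simp add: Nk Qk)
  also have "\<dots> \<le> (\<Sum>a\<in>UNIV. 3 / 4 * N a - Q a / (2 * l))"
  proof (rule member_le_sum)
    show "0 \<le> 3 / 4 * N a - Q a / (2 * l)" if "a \<in> UNIV - {k}" for a
    proof -
      have "Q a / (2 * l) \<le> (l / 2 * N a) / (2 * l)" using QN[of a] that l(2) by (intro divide_right_mono) auto
      also have "\<dots> = N a / 4" using l(2) by simp
      finally show ?thesis using Npos[of a] by linarith
    qed
  qed auto
  also have "\<dots> = 3 / 4 * (\<Sum>a\<in>UNIV. N a) - (\<Sum>a\<in>UNIV. Q a) / (2 * l)"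
    by (simp add: sum_subtractf sum_distrib_left sum_divide_distrib)
  also have "\<dots> \<le> 2 * (P / \<eta>\<^sup>2) + n / \<eta>" by (rule main)
  finally have "l\<^sup>2 * \<eta>\<^sup>2 \<le> 8 * P + 4 * n * \<eta>" using \<eta>(2) by (simp add: field_simps power2_eq_square)
  moreover have "P \<le> B"
  proof -
    define u where "u = (\<Sum>b\<in>UNIV. d b *\<^sub>R e b)"
    have "dd u F x = P" unfolding u_def using dd_sum_vec[OF F] by (simp add: P_def power2_eq_square d_def)
    moreover have "dd u (dd u F) x = P" using comb(2)[OF u_def] by (simp add: P_def)
    ultimately have PB: "P * P \<le> B * P" using B[of u] by (simp add: power2_eq_square)
    have P0: "P \<ge> 0" by (simp add: P_def sum_nonneg)
    have "0 \<le> (dd v F x)\<^sup>2" by simp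
    also have "\<dots> \<le> B" using B[of v] q by simp
    finally show ?thesis using PB P0 by (cases "P = 0") auto
  qed
  ultimately show ?thesis by linarith
qed

lemma cubic_estimate:
  fixes F :: "real^'m::finite \<Rightarrow> real"
  assumes F: "smooth F" and ma: "\<And>x. det (hessian F x) = c"
    and pos: "\<And>x u. u \<noteq> 0 \<Longrightarrow> dd u (dd u F) x > 0"
    and K: "compact {x. F x \<le> M}"
    and B: "\<And>x u. F x \<le> M \<Longrightarrow> (dd u F x)\<^sup>2 \<le> B * dd u (dd u F) x"
    and n_def: "n = CARD('m)" and x: "F x < M" and t: "dd u (dd u (dd u F)) x > 0"
    and nonneg: "\<And>x. F x \<ge> 0"
  shows "(dd u (dd u (dd u F)) x)\<^sup>2 * (M - F x)\<^sup>2 \<le> (8 * B + 4 * real n * M) * (dd u (dd u F) x) ^ 3"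
proof -
  define f where "f x u = dd u (dd u (dd u F)) x * (M - F x) / sqrt (dd u (dd u F) x) ^ 3" for x u
  have u: "u \<noteq> 0" using t by (auto simp: dd_zero_vec smooth_dd F)
  have qne: "dd y (dd y F) x \<noteq> 0" if "norm y = 1" for x y using pos[of y x] that norm_zero by fastforce
  have cont: "continuous_on ({x. F x \<le> M} \<times> sphere 0 1) (\<lambda>z. f (fst z) (snd z))"
    unfolding f_def
    by (intro continuous_intros continuous_dd3 continuous_dd2 F
        continuous_on_compose2[OF smooth_continuous_on[OF F, of UNIV]])
      (auto simp: qne)
  have hom: "f x (r *\<^sub>R u) = f x u" if "r > 0" for x u r
    using that by (simp add: f_def dd2_scale dd3_scale F real_sqrt_mult power_mult_distrib)
  obtain x0 v0 where x0: "F x0 \<le> M" "v0 \<noteq> 0" and mx: "\<And>x u. F x \<le> M \<Longrightarrow> u \<noteq> 0 \<Longrightarrow> f x u \<le> f x0 v0"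
    using homogeneous_max[OF K cont, of x u] hom x u by auto
  have fxu: "f x u > 0" using t x pos[OF u, of x] by (simp add: f_def)
  then have f0: "f x0 v0 > 0" using mx[of x u] x u by linarith
  have q0: "dd v0 (dd v0 F) x0 > 0" using pos x0(2) by blast
  define \<eta> where "\<eta> = M - F x0"
  have \<eta>: "\<eta> > 0" using f0 x0(1) by (cases "F x0 = M") (auto simp: \<eta>_def f_def)
  define r where "r = 1 / sqrt (dd v0 (dd v0 F) x0)"
  have r: "r > 0" using q0 by (simp add: r_def)
  define v where "v = r *\<^sub>R v0"
  define l where "l = dd v (dd v (dd v F)) x0"
  have q: "dd v (dd v F) x0 = 1"
    using q0 by (simp add: v_def dd2_scale F r_def power_divide)
  have fv: "f x0 v0 = l * \<eta>"
    using hom[OF r, of x0 v0] by (simp add: f_def v_def[symmetric] q l_def \<eta>_def)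
  then have l: "l > 0" using f0 \<eta> by (simp add: zero_less_mult_iff)
  have lnmx: "ln (dd u (dd u (dd u F)) y) - 3 / 2 * ln (dd u (dd u F) y) + ln (M - F y) \<le> ln l + ln \<eta>"
    if y: "F y < M" "dd u (dd u (dd u F)) y > 0" "dd u (dd u F) y > 0" for y u
  proof -
    have u: "u \<noteq> 0" using y(3) by (auto simp: dd_zero_vec smooth_dd F)
    have "ln (f y u) \<le> ln (l * \<eta>)" using mx[of y u] y u fv l \<eta> by (simp add: f_def)
    moreover have "ln (f y u) = ln (dd u (dd u (dd u F)) y) - 3 / 2 * ln (dd u (dd u F) y) + ln (M - F y)"
      using y by (simp add: f_def ln_div ln_mult ln_realpow ln_sqrt)
    moreover have "ln (l * \<eta>) = ln l + ln \<eta>" using l \<eta> by (simp add: ln_mult)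
    ultimately show ?thesis by linarith
  qed
  have "l\<^sup>2 * \<eta>\<^sup>2 \<le> 8 * B + 4 * real n * \<eta>"
    by (rule cubic_bound_at_maximum[OF F ma pos _ \<eta>_def \<eta> l_def[symmetric] l q B[OF x0(1)] lnmx]) (simp_all add: n_def)
  also have "\<dots> \<le> 8 * B + 4 * real n * M" using nonneg[of x0] by (simp add: \<eta>_def mult_left_mono)
  finally have le: "(f x0 v0)\<^sup>2 \<le> 8 * B + 4 * real n * M" by (simp add: fv power_mult_distrib)
  have "(f x u)\<^sup>2 \<le> (f x0 v0)\<^sup>2" using mx[of x u] x u fxu by (intro power_mono) auto
  with le have "(f x u)\<^sup>2 \<le> 8 * B + 4 * real n * M" by linarith
  moreover have "(sqrt (dd u (dd u F) x) ^ 3)\<^sup>2 = dd u (dd u F) x ^ 3"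
    using pos[OF u, of x] by (metis less_imp_le power_commutes power_mult real_sqrt_pow2 mult.commute)
  then have "(f x u)\<^sup>2 = (dd u (dd u (dd u F)) x)\<^sup>2 * (M - F x)\<^sup>2 / dd u (dd u F) x ^ 3"
    by (simp add: f_def power_divide power_mult_distrib)
  ultimately show ?thesis using pos[OF u, of x] by (simp add: divide_le_eq)
qed

text \<open>On \<open>{F \<le> M}\<close> the gradient estimate for the section of height \<open>2 M\<close> gives
  \<open>B = O(M)\<close>. The estimate of third derivatives on \<open>{F \<le> M}\<close> then reads
  \<open>D\<^sup>3F(u,u,u)\<^sup>2 M\<^sup>2 \<le> C' M\<close> at \<open>b\<close>, with \<open>C'\<close> independent of \<open>M\<close>.\<close>

lemma third_derivative_nonpos_at_minimum:
  fixes F :: "real^'m::finite \<Rightarrow> real"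
  assumes F: "smooth F" and ma: "\<And>x. det (hessian F x) = c"
    and pos: "\<And>x u. u \<noteq> 0 \<Longrightarrow> dd u (dd u F) x > 0"
    and K: "\<And>M. compact {x. F x \<le> M}"
    and nonneg: "\<And>x. F x \<ge> 0" and b: "F b = 0"
  shows "dd u (dd u (dd u F)) b \<le> 0"
proof (rule ccontr)
  assume "\<not> dd u (dd u (dd u F)) b \<le> 0"
  then have t: "dd u (dd u (dd u F)) b > 0" by simp
  define n where "n = CARD('m)"
  define C where "C = ((real n)\<^sup>2 + 3 * real n) * 2 ^ n"
  define D where "D = (16 * C + 4 * real n) * dd u (dd u F) b ^ 3"
  have le: "(dd u (dd u (dd u F)) b)\<^sup>2 * M \<le> D" if M: "M > 0" for M
  proof -
    have B: "(dd w F x)\<^sup>2 \<le> (C * (2 * M)) * dd w (dd w F) x" if x: "F x \<le> M" for x w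
    proof -
      have "(dd w F x)\<^sup>2 * M ^ n \<le> (dd w F x)\<^sup>2 * (2 * M - F x) ^ n"
        using M x by (intro mult_left_mono power_mono) auto
      also have "\<dots> \<le> ((real n)\<^sup>2 + 3 * real n) * (2 * M) ^ Suc n * dd w (dd w F) x"
        using x M by (intro gradient_estimate[OF F ma pos nonneg K n_def]) auto
      also have "\<dots> = (C * (2 * M)) * dd w (dd w F) x * M ^ n"
        by (simp add: C_def power_mult_distrib)
      finally show ?thesis using M by simp
    qed
    have "(dd u (dd u (dd u F)) b)\<^sup>2 * (M - F b)\<^sup>2 \<le> (8 * (C * (2 * M)) + 4 * real n * M) * dd u (dd u F) b ^ 3"
      by (rule cubic_estimate[OF F ma pos K B n_def _ t nonneg]) (use M b in auto)
    then have "M * ((dd u (dd u (dd u F)) b)\<^sup>2 * M) \<le> M * D"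
      by (simp add: b D_def power2_eq_square algebra_simps)
    then show ?thesis using M by simp
  qed
  define T where "T = (dd u (dd u (dd u F)) b)\<^sup>2"
  have T: "T > 0" using t by (simp add: T_def)
  have "T * ((\<bar>D\<bar> + 1) / T) \<le> D" unfolding T_def by (rule le) (use T in \<open>auto simp: T_def\<close>)
  then show False using T by simp
qed

section \<open>Convexity and compact sections\<close>

lemma convex_tangent:
  assumes F: "smooth F" and cvx: "convex_on UNIV F"
  shows "F y \<ge> F x + dd (y - x) F x"
proof -
  define g where "g s = F (x + s *\<^sub>R (y - x))" for s :: real
  have "convex_on UNIV g"
  proof (rule convex_onI)
    fix t a b :: real assume t: "0 < t" "t < 1"
    have "x + ((1 - t) *\<^sub>R a + t *\<^sub>R b) *\<^sub>R (y - x) = (1 - t) *\<^sub>R (x + a *\<^sub>R (y - x)) + t *\<^sub>R (x + b *\<^sub>R (y - x))"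
      by (simp add: algebra_simps)
    then show "g ((1 - t) *\<^sub>R a + t *\<^sub>R b) \<le> (1 - t) * g a + t * g b"
      unfolding g_def using convex_onD[OF cvx, of t "x + a *\<^sub>R (y - x)" "x + b *\<^sub>R (y - x)"] t by simp
  qed simp
  moreover have "(g has_real_derivative dd (y - x) F x) (at 0)"
    using dd_line[OF F, of x "y - x" 0] by (simp add: g_def[abs_def])
  ultimately have "g 1 - g 0 \<ge> dd (y - x) F x * (1 - 0)"
    by (intro convex_on_imp_above_tangent[of UNIV]) auto
  then show ?thesis by (simp add: g_def)
qed

text \<open>The tangent inequality says that \<open>s \<mapsto> s DF(u) - F(x + s u)\<close> is maximal at \<open>0\<close>.\<close>

lemma convex_dd2_nonneg:
  assumes F: "smooth F" and cvx: "convex_on UNIV F"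
  shows "dd u (dd u F) x \<ge> 0"
proof -
  note j = jet2_add[OF jet2_mult[OF jet2_const[of "-1"] jet2_line[OF F, of x u]] jet2_mult[OF jet2_id jet2_const[of "dd u F x"]]]
  have "- 1 * F (x + s *\<^sub>R u) + s * dd u F x \<le> - 1 * F (x + 0 *\<^sub>R u) + 0 * dd u F x" for s
    using convex_tangent[OF F cvx, of x "x + s *\<^sub>R u"] by (simp add: dd_scaleR_vec F)
  then have "\<forall>\<^sub>F s in nhds 0. - 1 * F (x + s *\<^sub>R u) + s * dd u F x \<le> - 1 * F (x + 0 *\<^sub>R u) + 0 * dd u F x"
    by (intro always_eventually allI)
  from jet2_local_max[OF j this] show ?thesis by simp
qed

text \<open>A null vector of the semidefinite form \<open>D\<^sup>2F\<close> lies in its kernel, because otherwise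
  the form would take negative values; a kernel is excluded by the determinant.\<close>

lemma hessian_pos_def:
  fixes F :: "real^'m::finite \<Rightarrow> real"
  assumes F: "smooth F" and cvx: "convex_on UNIV F" and det: "det (hessian F x) \<noteq> 0" and u: "u \<noteq> 0"
  shows "dd u (dd u F) x > 0"
proof (rule ccontr)
  assume "\<not> dd u (dd u F) x > 0"
  then have 0: "dd u (dd u F) x = 0" using convex_dd2_nonneg[OF F cvx, of u x] by simp
  have *: "dd w (dd u F) x = 0" for w
  proof (rule ccontr)
    assume ne: "dd w (dd u F) x \<noteq> 0"
    \<comment> \<open>The value \<open>s\<close> at which the affine function \<open>s \<mapsto> D\<^sup>2F(w + s u, w + s u)\<close> equals \<open>-1\<close>.\<close>
    define s where "s = - (dd w (dd w F) x + 1) / (2 * dd w (dd u F) x)"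
    have "dd (w + s *\<^sub>R u) (dd (w + s *\<^sub>R u) F) x = dd w (dd w F) x + s * (2 * dd w (dd u F) x)"
      by (simp add: dd2_expand[OF F] 0)
    also have "\<dots> = - 1" using ne by (simp add: s_def)
    finally show False using convex_dd2_nonneg[OF F cvx, of "w + s *\<^sub>R u" x] by simp
  qed
  have "(hessian F x *v u) $ i = dd (axis i 1) (dd u F) x" for i
  proof -
    have "dd (axis i 1) (dd u F) x = (\<Sum>a\<in>UNIV. if a = i then (\<Sum>j\<in>UNIV. hessian F x $ a $ j * u $ j) else 0)"
      unfolding dd2_hessian[OF F] by (intro sum.cong refl) (simp add: axis_def)
    then show ?thesis by (simp add: matrix_vector_mult_def)
  qed
  then have "hessian F x *v u = 0" by (simp add: * vec_eq_iff)
  then have "u = 0" using det invertible_det_nz[of "hessian F x"]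
    by (metis invertible_def matrix_left_invertible_ker)
  with u show False by simp
qed

text \<open>\<open>F\<close> is positive on the unit sphere around its minimum \<open>b\<close>, and convexity propagates the
  minimum \<open>\<delta>\<close> over that sphere to linear growth of slope \<open>\<delta>\<close> along every ray.\<close>

lemma compact_sublevel:
  fixes F :: "real^'m::finite \<Rightarrow> real"
  assumes F: "smooth F" and pos: "\<And>x u. u \<noteq> 0 \<Longrightarrow> dd u (dd u F) x > 0"
    and tangent: "\<And>x y. F y \<ge> F x + dd (y - x) F x"
    and b: "F b = 0" and crit: "\<And>u. dd u F b = 0"
  shows "compact {x. F x \<le> M}"
proof -
  have Fpos: "F (b + u) > 0" if u: "u \<noteq> 0" for u
  proof -
    have d1: "((\<lambda>s. F (b + s *\<^sub>R u)) has_real_derivative dd u F (b + s *\<^sub>R u)) (at s)" for s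
      by (rule dd_line[OF F])
    have d2: "((\<lambda>s. dd u F (b + s *\<^sub>R u)) has_real_derivative dd u (dd u F) (b + s *\<^sub>R u)) (at s)" for s
      by (intro dd_line smooth_dd F)
    obtain z where z: "0 < z" "F (b + 1 *\<^sub>R u) - F (b + 0 *\<^sub>R u) = (1 - 0) * dd u F (b + z *\<^sub>R u)"
      using MVT2[OF zero_less_one d1] by blast
    obtain y where y: "dd u F (b + z *\<^sub>R u) - dd u F (b + 0 *\<^sub>R u) = (z - 0) * dd u (dd u F) (b + y *\<^sub>R u)"
      using MVT2[OF z(1) d2] by blast
    have "(z - 0) * dd u (dd u F) (b + y *\<^sub>R u) > 0" using z(1) pos[OF u] by simp
    then show ?thesis using z(2) y by (simp add: b crit)
  qed
  have "continuous_on (sphere b 1) F" by (rule smooth_continuous_on[OF F])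
  moreover have "sphere b 1 \<noteq> {}" by simp
  ultimately obtain z where z: "z \<in> sphere b 1" "\<And>y. y \<in> sphere b 1 \<Longrightarrow> F z \<le> F y"
    using continuous_attains_inf[of "sphere b 1" F] by auto
  define \<delta> where "\<delta> = F z"
  have \<delta>: "\<delta> > 0" using Fpos[of "z - b"] z(1) by (cases "z = b") (auto simp: \<delta>_def)
  have growth: "F x \<ge> dist b x * \<delta>" if x: "dist b x > 1" for x
  proof -
    define r where "r = dist b x"
    define w where "w = (x - b) /\<^sub>R r"
    have r1: "r > 1" using x by (simp add: r_def)
    then have r: "r > 1" "x = b + r *\<^sub>R w" by (auto simp: w_def)
    have "norm (x - b) = r" by (simp add: r_def dist_norm norm_minus_commute)
    then have "norm w = 1" using r(1) by (simp add: w_def)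
    then have Fw: "F (b + w) \<ge> \<delta>" using z(2)[of "b + w"] by (simp add: \<delta>_def dist_norm)
    have "dd (b - (b + w)) F (b + w) = - dd w F (b + w)"
      using dd_scaleR_vec[OF F, of "-1" w "b + w"] by simp
    then have 1: "dd w F (b + w) \<ge> F (b + w)" using tangent[of "b + w" b] b by simp
    have "x - (b + w) = (r - 1) *\<^sub>R w" by (simp add: r(2) algebra_simps)
    then have "F x \<ge> F (b + w) + (r - 1) * dd w F (b + w)"
      using tangent[of "b + w" x] by (simp add: dd_scaleR_vec F)
    moreover have "(r - 1) * dd w F (b + w) \<ge> (r - 1) * F (b + w)" using 1 r by (intro mult_left_mono) auto
    ultimately have "F x \<ge> r * F (b + w)" by (simp add: algebra_simps)
    moreover have "r * F (b + w) \<ge> r * \<delta>" using Fw r by (intro mult_left_mono) auto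
    ultimately show ?thesis by (simp add: r_def)
  qed
  have "{x. F x \<le> M} \<subseteq> cball b (max 1 (M / \<delta>))"
  proof
    fix x assume "x \<in> {x. F x \<le> M}"
    then have "dist b x \<le> 1 \<or> dist b x \<le> M / \<delta>" using growth[of x] \<delta> by (cases "dist b x > 1") (auto simp: pos_le_divide_eq)
    then show "x \<in> cball b (max 1 (M / \<delta>))" by auto
  qed
  then have "bounded {x. F x \<le> M}" using bounded_cball bounded_subset by blast
  moreover have "closed {x. F x \<le> M}"
    by (intro closed_Collect_le smooth_continuous_on[OF F] continuous_on_const)
  ultimately show ?thesis by (simp add: compact_eq_bounded_closed)
qed

section \<open>Entire solutions\<close>

text \<open>Subtracting the tangent affine function at \<open>b\<close> preserves all second and higher derivatives,
  hence the equation. The sign statement for \<open>u\<close> and for \<open>-u\<close> gives equality, since cubic forms are odd.\<close>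

lemma third_derivative_eq_zero:
  fixes F :: "real^'m::finite \<Rightarrow> real"
  assumes F: "smooth F" and cvx: "convex_on UNIV F" and c: "c > 0" and ma: "\<And>x. det (hessian F x) = c"
  shows "dd u (dd u (dd u F)) b = 0"
proof -
  define L where "L x = dd x F b" for x
  define k where "k = F b - L b"
  define G where "G x = (F x - L x) - k" for x
  have L: "linear L" unfolding L_def[abs_def] by (rule linear_dd[OF F])
  have G: "smooth G" unfolding G_def[abs_def] by (intro smooth_diff F smooth_linear L smooth_const)
  have dG: "dd w G = (\<lambda>x. dd w F x - L w)" for w
    unfolding G_def[abs_def] by (simp add: dd_diff F smooth_diff smooth_linear L smooth_const dd_linear dd_const)
  have d2G: "dd v (dd w G) = dd v (dd w F)" for v w
    unfolding dG by (simp add: dd_diff F smooth_dd smooth_const dd_const)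
  have "hessian G x = hessian F x" for x
    by (simp add: vec_eq_iff hessian_eq_dd F G d2G)
  then have maG: "det (hessian G x) = c" for x by (simp add: ma)
  have posG: "dd w (dd w G) x > 0" if "w \<noteq> 0" for w x
    unfolding d2G using hessian_pos_def[OF F cvx _ that, of x] c by (simp add: ma)
  have tangent: "G y \<ge> G x + dd (y - x) G x" for x y
    using convex_tangent[OF F cvx, of x y] linear_diff[OF L, of y x] by (simp add: dG G_def)
  have Gb: "G b = 0" by (simp add: G_def k_def)
  have crit: "dd w G b = 0" for w by (simp add: dG L_def)
  have "G x \<ge> 0" for x using tangent[of b x] by (simp add: Gb crit)
  note le = third_derivative_nonpos_at_minimum[OF G maG posG compact_sublevel[OF G posG tangent Gb crit] this Gb, unfolded d2G]
  have "- dd u (dd u (dd u F)) b \<le> 0" using le[of "- 1 *\<^sub>R u"] by (simp only: dd3_scale[OF F]) simp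
  with le[of u] show ?thesis by simp
qed

theorem mainTheorem3:
  fixes F :: "real^'m::finite \<Rightarrow> real" and c :: real
  assumes "smooth F"
    and "convex_on UNIV F"
    and "c > 0"
    and "\<And>x. det (hessian F x) = c"
  shows "quadratic_polynomial F"
proof -
  note F = assms(1)
  note d3 = third_derivative_eq_zero[OF assms]
  have taylor: "F x = F 0 + dd x F 0 + dd x (dd x F) 0 / 2" for x
  proof -
    have d: "((\<lambda>s. f (0 + s *\<^sub>R x)) has_real_derivative dd x f (0 + s *\<^sub>R x)) (at s)" if "smooth f" for f s
      by (rule dd_line[OF that])
    have "((\<lambda>s. dd x (dd x F) (0 + s *\<^sub>R x)) has_real_derivative 0) (at s)" for s
      using d[OF smooth_dd[OF smooth_dd[OF F]], of x x s] by (simp add: d3)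
    then have 2: "dd x (dd x F) (0 + s *\<^sub>R x) = dd x (dd x F) 0" for s
      using DERIV_isconst_all[of "\<lambda>s. dd x (dd x F) (0 + s *\<^sub>R x)" s 0] by simp
    have "((\<lambda>s. dd x F (0 + s *\<^sub>R x) - s * dd x (dd x F) 0) has_real_derivative 0) (at s)" for s
      using d[OF smooth_dd[OF F], of x s] unfolding 2 by (auto intro!: derivative_eq_intros)
    then have 1: "dd x F (0 + s *\<^sub>R x) = dd x F 0 + s * dd x (dd x F) 0" for s
      using DERIV_isconst_all[of "\<lambda>s. dd x F (0 + s *\<^sub>R x) - s * dd x (dd x F) 0" s 0] by simp
    have "((\<lambda>s. F (0 + s *\<^sub>R x) - s * dd x F 0 - s\<^sup>2 * (dd x (dd x F) 0 / 2)) has_real_derivative 0) (at s)" for s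
      using d[OF F, of s] unfolding 1 by (auto intro!: derivative_eq_intros)
    then show ?thesis
      using DERIV_isconst_all[of "\<lambda>s. F (0 + s *\<^sub>R x) - s * dd x F 0 - s\<^sup>2 * (dd x (dd x F) 0 / 2)" 1 0] by simp
  qed
  have "F x = (\<Sum>i\<in>UNIV. \<Sum>j\<in>UNIV. (hessian F 0 $ i $ j / 2) * x $ i * x $ j)
      + (\<Sum>i\<in>UNIV. dd (axis i 1) F 0 * x $ i) + F 0" for x
    unfolding taylor[of x] dd2_hessian[OF F] dd_axis[OF F, of x]
    by (simp add: sum_divide_distrib mult_ac)
  then show ?thesis unfolding quadratic_polynomial_def
    by (intro exI[of _ "\<lambda>i j. hessian F 0 $ i $ j / 2"] exI[of _ "\<lambda>i. dd (axis i 1) F 0"] exI[of _ "F 0"] allI)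
qed

end
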